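(* Let $n\ge 1$, let $\mu=(\mu_1\ge\dots\ge\mu_n\ge 0)$ be a partition with exactly $p$ nonzero parts, and let $S$ be a semistandard Young tableau (ssyt) of shape $\mu$ with entries in $[n]=\{1,\dots,n\}$. Let $\tau\in\mathfrak S_n$ be the permutation associated to $S$ by the maximal-line procedure described in the context. Then: (1) the left key of $S$ is the key tableau of shape $\mu$ corresponding to the coset $\tau\mathfrak S_\mu$; and (2) $\tau$ is the unique maximal element, in the Bruhat order on $\mathfrak S_n$, of the coset $\tau\mathfrak S_\mu$.
   Context: Tableaux use English convention; a ssyt has rows weakly increasing left to right and columns strictly increasing top to bottom. $\mathfrak S_n$ acts on compositions $f:[n]\to\mathbb Z_{\ge0}$ by $(wf)(i)=f(w^{-1}i)$; $\mathfrak S_\mu$ is the stabiliser of $\mu$ (viewed as the composition $i\mapsto\mu_i$). A key tableau is a ssyt whose entries in each column (other than the first) form a subset of the entries of the previous column. To $\sigma=\sigma_1\dots\sigma_n\in\mathfrak S_n$ (one-line notation) is associated the key tableau of shape $\mu$ whose column with $j$ boxes consists of $\sigma_1,\dots,\sigma_j$ in increasing order top to bottom; it depends only on $\sigma\mathfrak S_\mu$, giving a bijection between left cosets of $\mathfrak S_\mu$ and key tableaux of shape $\mu$. Left key (Lascoux–Schützenberger): let $S$ have nonempty columns of lengths $b(1)\ge\dots\ge b(c)$. The $j$-th column of the left key of $S$ is the first column of the ssyt obtained from $S$ by jeu de taquin (rectification-equivalent ssyt) of the skew shape whose columns have lengths $b(j),b(1),\dots,b(j-1),b(j+1),\dots,b(c)$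 in order and whose removed inner shape is a single column of $b(1)-b(j)$ boxes (the first column of the skew shape occupying rows $b(1)-b(j)+1,\dots,b(1)$). The right key is defined likewise, its $j$-th column being the last column of the jeu-de-taquin-equivalent ssyt of skew shape with column lengths $b(1),\dots,b(j-1),b(j+1),\dots,b(c),b(j)$ and inner shape a $(b(j)-b(c))\times(c-1)$ rectangle. (The result is independent of these choices.) Procedure for $\tau$: for a nonempty ssyt $T$ with columns $T(1),\dots,T(c)$, define $v_c$ to be the largest (bottom) entry of $T(c)$ and, for $i=c-1,\dots,1$, $v_i$ to be the largest entry of $T(i)$ that is $\le v_{i+1}$ (such an entry exists). Put $w(T):=v_1$, and let $T'$ be the ssyt obtained from $T$ by deleting the boxes containing $v_1,\dots,v_c$ and pushing the remaining boxes of each column up to form a Young shape. Set $S_1:=S$ and for $1\le j\le p$ put $\tau_j:=w(S_j)$, $S_{j+1}:=S_j'$. Finally let $\tau_{p+1},\dots,\tau_n$ be the elements of $[n]\setminus\{\tau_1,\dots,\tau_p\}$ in decreasing order, and $\tau=\tau_1\dots\tau_n$. *)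

theory Defs
  imports "HOL-Combinatorics.Permutations" "HOL-Combinatorics.Transposition"
begin

section \<open>Fillings of diagrams\<close>

text \<open>
  English convention: a cell is a pair (row, column), both counted from 1 and rows numbered from
  top to bottom. A filling is a finite partial map whose domain is the set of its boxes.
\<close>

type_synonym cell = "nat \<times> nat"
type_synonym filling = "cell \<Rightarrow> nat option"

definition young :: "cell set \<Rightarrow> bool" where
  "young D \<longleftrightarrow> finite D \<and> (\<forall>(i, j)\<in>D. 1 \<le> i \<and> 1 \<le> j) \<and>
     (\<forall>(i, j)\<in>D. \<forall>i'\<in>{1..i}. \<forall>j'\<in>{1..j}. (i', j') \<in> D)"

text \<open>Only the values \<open>\<mu> 1, \<dots>, \<mu> n\<close> of a composition \<open>\<mu>\<close> matter.\<close>

definition diagram :: "nat \<Rightarrow> (nat \<Rightarrow> nat) \<Rightarrow> cell set" where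
  "diagram n \<mu> = {(i, j). i \<in> {1..n} \<and> j \<in> {1..\<mu> i}}"

definition col_len :: "cell set \<Rightarrow> nat \<Rightarrow> nat" where
  "col_len D k = card {i. (i, k) \<in> D}"

definition num_cols :: "cell set \<Rightarrow> nat" where
  "num_cols D = card (snd ` D)"

definition semistandard :: "filling \<Rightarrow> bool" where
  "semistandard T \<longleftrightarrow>
     (\<forall>i j j' a b. j < j' \<longrightarrow> T (i, j) = Some a \<longrightarrow> T (i, j') = Some b \<longrightarrow> a \<le> b) \<and>
     (\<forall>i i' j a b. i < i' \<longrightarrow> T (i, j) = Some a \<longrightarrow> T (i', j) = Some b \<longrightarrow> a < b)"

definition ssyt :: "nat \<Rightarrow> (nat \<Rightarrow> nat) \<Rightarrow> filling \<Rightarrow> bool" where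
  "ssyt n \<mu> S \<longleftrightarrow> dom S = diagram n \<mu> \<and> semistandard S \<and> ran S \<subseteq> {1..n}"

definition column :: "filling \<Rightarrow> nat \<Rightarrow> nat list" where
  "column T k = map (\<lambda>i. the (T (i, k))) (sorted_list_of_set {i. (i, k) \<in> dom T})"

definition columns :: "filling \<Rightarrow> nat list list" where
  "columns T = map (column T) [1..<Suc (num_cols (dom T))]"

text \<open>Columns are listed from left to right, each from top to bottom, and are aligned at row 1;
  empty lists at the end contribute no boxes.\<close>

definition of_columns :: "nat list list \<Rightarrow> filling" where
  "of_columns Cs = (\<lambda>(i, k).
     if k \<in> {1..length Cs} \<and> i \<in> {1..length (Cs ! (k - 1))} then Some (Cs ! (k - 1) ! (i - 1))
     else None)"


section \<open>Permutations, cosets, Bruhat order, key tableaux\<close>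

text \<open>Elements of the symmetric group are functions \<open>\<sigma>\<close> with \<open>\<sigma> permutes {1..n}\<close>, the product is
  composition, and the one-line notation of \<open>\<sigma>\<close> is \<open>\<sigma> 1, \<dots>, \<sigma> n\<close>.\<close>

definition act :: "(nat \<Rightarrow> nat) \<Rightarrow> (nat \<Rightarrow> nat) \<Rightarrow> nat \<Rightarrow> nat" where
  "act w f = (\<lambda>i. f (inv w i))"

definition stabiliser :: "nat \<Rightarrow> (nat \<Rightarrow> nat) \<Rightarrow> (nat \<Rightarrow> nat) set" where
  "stabiliser n \<mu> = {w. w permutes {1..n} \<and> (\<forall>i\<in>{1..n}. act w \<mu> i = \<mu> i)}"

definition left_coset :: "(nat \<Rightarrow> nat) \<Rightarrow> (nat \<Rightarrow> nat) set \<Rightarrow> (nat \<Rightarrow> nat) set" where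
  "left_coset \<sigma> H = (\<lambda>w. \<sigma> \<circ> w) ` H"

definition perm_length :: "nat \<Rightarrow> (nat \<Rightarrow> nat) \<Rightarrow> nat" where
  "perm_length n \<sigma> = card {(i, j). 1 \<le> i \<and> i < j \<and> j \<le> n \<and> \<sigma> j < \<sigma> i}"

definition bruhat_step :: "nat \<Rightarrow> (nat \<Rightarrow> nat) \<Rightarrow> (nat \<Rightarrow> nat) \<Rightarrow> bool" where
  "bruhat_step n u v \<longleftrightarrow>
     u permutes {1..n} \<and>
     (\<exists>i\<in>{1..n}. \<exists>j\<in>{1..n}. i \<noteq> j \<and> v = u \<circ> Transposition.transpose i j) \<and>
     perm_length n u < perm_length n v"

definition bruhat_le :: "nat \<Rightarrow> (nat \<Rightarrow> nat) \<Rightarrow> (nat \<Rightarrow> nat) \<Rightarrow> bool" where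
  "bruhat_le n u v \<longleftrightarrow> u permutes {1..n} \<and> v permutes {1..n} \<and> (bruhat_step n)\<^sup>*\<^sup>* u v"

definition bruhat_maximal :: "nat \<Rightarrow> (nat \<Rightarrow> nat) set \<Rightarrow> (nat \<Rightarrow> nat) \<Rightarrow> bool" where
  "bruhat_maximal n C \<sigma> \<longleftrightarrow> \<sigma> \<in> C \<and> (\<forall>\<rho>\<in>C. bruhat_le n \<sigma> \<rho> \<longrightarrow> \<rho> = \<sigma>)"

definition key_tableau :: "nat \<Rightarrow> (nat \<Rightarrow> nat) \<Rightarrow> (nat \<Rightarrow> nat) \<Rightarrow> filling" where
  "key_tableau n \<mu> \<sigma> = of_columns
     (map (\<lambda>k. sorted_list_of_set (\<sigma> ` {1..col_len (diagram n \<mu>) k}))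
        [1..<Suc (num_cols (diagram n \<mu>))])"

text \<open>The common value of \<open>key_tableau n \<mu>\<close> on a left coset of the stabiliser; see
  \<open>coset_key_left_coset\<close> below.\<close>

definition coset_key :: "nat \<Rightarrow> (nat \<Rightarrow> nat) \<Rightarrow> (nat \<Rightarrow> nat) set \<Rightarrow> filling" where
  "coset_key n \<mu> C = the_elem (key_tableau n \<mu> ` C)"

lemma diagram_column:
  assumes "antimono_on {1..n} \<mu>" "1 \<le> k"
  shows "{1..col_len (diagram n \<mu>) k} = {i\<in>{1..n}. k \<le> \<mu> i}"
proof -
  let ?A = "{i\<in>{1..n}. k \<le> \<mu> i}"
  have down: "i' \<in> ?A" if "i \<in> ?A" "1 \<le> i'" "i' \<le> i" for i i'
  proof -
    have "i \<in> {1..n}" "i' \<in> {1..n}" "k \<le> \<mu> i" using that by auto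
    moreover from this have "\<mu> i \<le> \<mu> i'" using monotone_onD[OF assms(1)] that(3) by blast
    ultimately show ?thesis by simp
  qed
  have fin: "finite ?A" by simp
  have "?A = {1..card ?A}"
  proof (cases "?A = {}")
    case True
    then show ?thesis by simp
  next
    case False
    have "?A = {1..Max ?A}"
    proof (intro equalityI subsetI)
      fix i assume "i \<in> ?A"
      then have "1 \<le> i" "i \<le> Max ?A" using Max_ge[OF fin] by auto
      then show "i \<in> {1..Max ?A}" by (simp only: atLeastAtMost_iff)
    next
      fix i assume "i \<in> {1..Max ?A}"
      then have "1 \<le> i" "i \<le> Max ?A" by (simp_all only: atLeastAtMost_iff)
      then show "i \<in> ?A" by (rule down[OF Max_in[OF fin False]])
    qed
    then obtain m where "?A = {1..m}" by blast
    then show ?thesis by (metis card_atLeastAtMost diff_Suc_1)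
  qed
  moreover have "{i. (i, k) \<in> diagram n \<mu>} = ?A"
    using assms(2) by (auto simp: diagram_def)
  ultimately show ?thesis by (simp add: col_len_def)
qed

lemma coset_key_left_coset:
  assumes "antimono_on {1..n} \<mu>"
  shows "coset_key n \<mu> (left_coset \<sigma> (stabiliser n \<mu>)) = key_tableau n \<mu> \<sigma>"
proof -
  have *: "key_tableau n \<mu> (\<sigma> \<circ> w) = key_tableau n \<mu> \<sigma>" if w: "w \<in> stabiliser n \<mu>" for w
  proof -
    have p: "w permutes {1..n}" and s: "\<forall>i\<in>{1..n}. \<mu> (inv w i) = \<mu> i"
      using w by (auto simp: stabiliser_def act_def)
    have "w ` {i\<in>{1..n}. k \<le> \<mu> i} = {i\<in>{1..n}. k \<le> \<mu> i}" for k
    proof (rule card_subset_eq)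
      show "w ` {i\<in>{1..n}. k \<le> \<mu> i} \<subseteq> {i\<in>{1..n}. k \<le> \<mu> i}"
      proof
        fix x assume "x \<in> w ` {i\<in>{1..n}. k \<le> \<mu> i}"
        then obtain i where i: "x = w i" "i \<in> {1..n}" "k \<le> \<mu> i" by blast
        have "x \<in> {1..n}" using i permutes_in_image[OF p] by simp
        moreover have "\<mu> x = \<mu> i"
          using s calculation i(1) permutes_inverses(2)[OF p] by metis
        ultimately show "x \<in> {i\<in>{1..n}. k \<le> \<mu> i}" using i(3) by simp
      qed
      show "card (w ` {i\<in>{1..n}. k \<le> \<mu> i}) = card {i\<in>{1..n}. k \<le> \<mu> i}"
        by (rule card_image) (meson inj_on_subset permutes_inj p subset_UNIV)
    qed simp
    then have "(\<sigma> \<circ> w) ` {1..col_len (diagram n \<mu>) k} = \<sigma> ` {1..col_len (diagram n \<mu>) k}"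
      if "1 \<le> k" for k
      unfolding diagram_column[OF assms that] image_comp[symmetric] by simp
    then have "map (\<lambda>k. sorted_list_of_set ((\<sigma> \<circ> w) ` {1..col_len (diagram n \<mu>) k}))
          [1..<Suc (num_cols (diagram n \<mu>))] =
        map (\<lambda>k. sorted_list_of_set (\<sigma> ` {1..col_len (diagram n \<mu>) k}))
          [1..<Suc (num_cols (diagram n \<mu>))]"
      by (intro map_cong refl) (simp only: set_upt atLeastLessThan_iff)
    then show ?thesis by (simp only: key_tableau_def)
  qed
  have "id \<in> stabiliser n \<mu>"
    by (simp add: stabiliser_def act_def permutes_id)
  then have "key_tableau n \<mu> ` left_coset \<sigma> (stabiliser n \<mu>) = {key_tableau n \<mu> \<sigma>}"
    unfolding left_coset_def image_image using * by (simp only: cong: image_cong) blast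
  then show ?thesis by (simp add: coset_key_def)
qed


section \<open>Jeu de taquin and the left key\<close>

text \<open>A pair consists of the current hole and the filling of the other boxes. The smaller of the
  right and lower neighbours moves into the hole; if they are equal the lower one moves.\<close>

inductive jdt_move :: "cell \<times> filling \<Rightarrow> cell \<times> filling \<Rightarrow> bool" where
  up: "\<lbrakk>T (Suc i, j) = Some b; \<forall>a. T (i, Suc j) = Some a \<longrightarrow> b \<le> a\<rbrakk> \<Longrightarrow>
     jdt_move ((i, j), T) ((Suc i, j), T((i, j) := Some b, (Suc i, j) := None))"
| left: "\<lbrakk>T (i, Suc j) = Some a; \<forall>b. T (Suc i, j) = Some b \<longrightarrow> a < b\<rbrakk> \<Longrightarrow>
     jdt_move ((i, j), T) ((i, Suc j), T((i, j) := Some a, (i, Suc j) := None))"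

definition jdt_slide :: "cell \<Rightarrow> filling \<Rightarrow> filling \<Rightarrow> bool" where
  "jdt_slide h T T' \<longleftrightarrow>
     (\<exists>i j. jdt_move\<^sup>*\<^sup>* (h, T) ((i, j), T') \<and> T' (Suc i, j) = None \<and> T' (i, Suc j) = None)"

text \<open>A skew filling is a pair of its removed inner shape and its filling (the boxes alone need not
  determine the inner shape). A step is a slide into a corner of the inner shape.\<close>

inductive jdt_step :: "cell set \<times> filling \<Rightarrow> cell set \<times> filling \<Rightarrow> bool" where
  "\<lbrakk>young I; h \<in> I; young (I - {h}); jdt_slide h T T'\<rbrakk> \<Longrightarrow> jdt_step (I, T) (I - {h}, T')"

definition rectifies_to :: "cell set \<times> filling \<Rightarrow> filling \<Rightarrow> bool" where
  "rectifies_to X R \<longleftrightarrow> jdt_step\<^sup>*\<^sup>* X ({}, R)"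

definition rectification_equiv :: "cell set \<times> filling \<Rightarrow> cell set \<times> filling \<Rightarrow> bool" where
  "rectification_equiv X Y \<longleftrightarrow> (\<exists>R. rectifies_to X R \<and> rectifies_to Y R)"

lemma rectification_equiv_straight:
  "rectification_equiv X ({}, S) \<longleftrightarrow> rectifies_to X S"
proof -
  have "R = S" if "jdt_step\<^sup>*\<^sup>* ({}, S) ({}, R)" for R
    using that by (cases rule: converse_rtranclpE) (auto elim: jdt_step.cases)
  then show ?thesis
    unfolding rectification_equiv_def rectifies_to_def by blast
qed

text \<open>Column \<open>k\<close> has \<open>bs ! (k - 1)\<close> boxes, below \<open>as ! (k - 1)\<close> removed ones.\<close>

definition skew_boxes :: "nat list \<Rightarrow> nat list \<Rightarrow> cell set" where
  "skew_boxes as bs = {(i, k). k \<in> {1..length bs} \<and>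
     as ! (k - 1) < i \<and> i \<le> as ! (k - 1) + bs ! (k - 1)}"

definition inner_boxes :: "nat list \<Rightarrow> cell set" where
  "inner_boxes as = {(i, k). k \<in> {1..length as} \<and> i \<in> {1..as ! (k - 1)}}"

text \<open>The column lengths \<open>bs\<close> below are
  \<open>b(j), b(1), \<dots>, b(j-1), b(j+1), \<dots>, b(c)\<close>.\<close>

definition left_key_column :: "filling \<Rightarrow> nat \<Rightarrow> nat list" where
  "left_key_column S j =
     (let b = col_len (dom S); c = num_cols (dom S);
          bs = map b (j # remove1 j [1..<Suc c]);
          as = (b 1 - b j) # replicate (c - 1) 0
      in THE C. \<exists>T. dom T = skew_boxes as bs \<and> semistandard T \<and>
           rectification_equiv (inner_boxes as, T) ({}, S) \<and> C = column T 1)"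

definition left_key :: "filling \<Rightarrow> filling" where
  "left_key S = of_columns (map (left_key_column S) [1..<Suc (num_cols (dom S))])"


section \<open>The maximal-line procedure\<close>

text \<open>The list \<open>v\<^sub>1, \<dots>, v\<^sub>c\<close> computed from the list of columns.\<close>

fun maximal_line :: "nat list list \<Rightarrow> nat list" where
  "maximal_line [] = []"
| "maximal_line [C] = [Max (set C)]"
| "maximal_line (C # D # Cs) =
     (let vs = maximal_line (D # Cs) in Max {x \<in> set C. x \<le> hd vs} # vs)"

definition line_head :: "filling \<Rightarrow> nat" where
  "line_head T = hd (maximal_line (columns T))"

definition delete_line :: "filling \<Rightarrow> filling" where
  "delete_line T = of_columns (map2 remove1 (maximal_line (columns T)) (columns T))"

definition line_perm :: "nat \<Rightarrow> nat \<Rightarrow> filling \<Rightarrow> nat \<Rightarrow> nat" where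
  "line_perm n p S =
     (let t = (\<lambda>j. line_head ((delete_line ^^ (j - 1)) S));
          rest = rev (sorted_list_of_set ({1..n} - t ` {1..p}))
      in (\<lambda>i. if i \<in> {1..p} then t i else if i \<in> {p<..n} then rest ! (i - p - 1) else i))"

end

theory Submission
  imports Defs
begin

text \<open>
  Both the left key and the maximal lines are governed by one matching between adjacent columns:
  if the elements of a set \<open>B\<close>, in any order, each pick the largest unused element of a column \<open>C\<close>
  below or equal to them, then the set of picked elements does not depend on the order. The first
  \<open>m\<close> maximal lines, where \<open>m\<close> is the length of column \<open>j\<close>, exhaust column \<open>j\<close>, so in columns
  \<open>j, j - 1, \<dots>, 1\<close> they pass through the sets obtained by iterating this matching, and the last of
  these sets is \<open>{\<tau> 1, \<dots>, \<tau> m}\<close>.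

  On the other hand, rectifying a skew tableau whose inner shape is a single column moves entries
  only to the left, one column at a time. Successive slides do not cross, hence the entries leaving
  a column are exactly the unmatched ones, and the entries that never leave the first column are
  given by the same iterated matching. Conversely, adding the unmatched entries of each column to
  the next one produces a skew tableau that rectifies to \<open>S\<close>. Comparing the numbers of entries
  below each bound turns all this into inequalities.

  For the Bruhat order, lines of equal length strictly decrease, so \<open>\<tau>\<close> is decreasing on the blocks
  where \<open>\<mu>\<close> is constant; any other element of the coset has an ascent inside a block.
\<close>

section \<open>Counting functions and the crossing rule\<close>

text \<open>Columns are treated as sets: the row of an entry is its rank \<open>cnt\<close> in its
  column, so semistandardness becomes a pointwise inequality of counting functions and no row
  indices need updating during a slide. The \<open>s\<close> boxes of the removed inner column hold
  virtual entries \<open>0\<close>, ..., \<open>s - 1\<close>; ranks then agree with rows in the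
  skew shape as well, and a slide deletes the largest virtual entry. Entries of a competing skew
  tableau are arbitrary naturals, possibly 0, so real entries are shifted by some
  \<open>N \<ge> s\<close> to stay above the virtual ones.

  The left key column is a definite description over all skew tableaux of the given shape that
  rectify to \<open>S\<close>, so one must be constructed and every other shown to have the same
  first column; hence both directions between slides and matchings. The obstacle is that each slide
  changes the columns met by the next. A barrier \<open>W\<close> carried through the induction
  overcomes this: each slide path is such a barrier for its successors.\<close>

definition cnt :: "nat set \<Rightarrow> nat \<Rightarrow> nat" where
  "cnt P z = card (P \<inter> {..<z})"

lemma cnt_mono: "z \<le> z' \<Longrightarrow> cnt P z \<le> cnt P z'"
  unfolding cnt_def by (intro card_mono) auto

lemma cnt_0 [simp]: "cnt P 0 = 0"
  by (simp add: cnt_def)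

lemma cnt_empty [simp]: "cnt {} z = 0"
  by (simp add: cnt_def)

lemma cnt_Suc: "cnt P (Suc z) = cnt P z + (if z \<in> P then 1 else 0)"
  by (simp add: cnt_def lessThan_Suc)

lemma cnt_less: "x \<in> P \<Longrightarrow> x < z \<Longrightarrow> cnt P x < cnt P z"
  using cnt_mono[of "Suc x" z P] cnt_Suc[of P x] by simp

lemma cnt_less_iff: "x \<in> P \<Longrightarrow> cnt P x < cnt P z \<longleftrightarrow> x < z"
  using cnt_less[of x P z] cnt_mono[of z x P] by linarith

lemma cnt_inj: "x \<in> P \<Longrightarrow> y \<in> P \<Longrightarrow> cnt P x = cnt P y \<Longrightarrow> x = y"
  by (metis cnt_less less_irrefl linorder_neqE_nat)

lemma cnt_Un: "P \<inter> Q = {} \<Longrightarrow> cnt (P \<union> Q) z = cnt P z + cnt Q z"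
  unfolding cnt_def by (subst card_Un_disjoint[symmetric]) (auto intro: arg_cong[where f = card])

lemma cnt_insert: "y \<notin> P \<Longrightarrow> cnt (insert y P) z = cnt P z + (if y < z then 1 else 0)"
  by (auto simp: cnt_def)

lemma cnt_remove: "x \<in> P \<Longrightarrow> cnt P z = cnt (P - {x}) z + (if x < z then 1 else 0)"
  using cnt_insert[of x "P - {x}" z] by (simp add: insert_absorb)

lemma cnt_Diff: "X \<subseteq> P \<Longrightarrow> cnt P z = cnt (P - X) z + cnt X z"
  using cnt_Un[of "P - X" X z] by (simp add: Un_absorb2 Diff_Int_distrib2)

lemma cnt_eq_card: "P \<subseteq> {..<z} \<Longrightarrow> cnt P z = card P"
  by (simp add: cnt_def Int_absorb2)

lemma cnt_le_card: "finite P \<Longrightarrow> cnt P z \<le> card P"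
  unfolding cnt_def by (intro card_mono) auto

lemma cnt_lessThan: "cnt {..<s} z = min s z"
proof -
  have "{..<s} \<inter> {..<z} = {..<min s z}" by auto
  then show ?thesis by (simp add: cnt_def)
qed

lemma card_le_cnt: "finite P \<Longrightarrow> \<exists>z0. \<forall>z\<ge>z0. cnt P z = card P"
proof (intro exI allI impI)
  fix z assume "finite P" "Suc (Max (insert 0 P)) \<le> z"
  then show "cnt P z = card P" by (intro cnt_eq_card) (auto simp: Suc_le_eq)
qed

lemma cnt_leD_card:
  assumes "finite P" "finite Q" "\<And>z. cnt Q z \<le> cnt P z"
  shows "card Q \<le> card P"
proof -
  obtain z where "cnt Q z = card Q" using card_le_cnt[OF assms(2)] by blast
  then show ?thesis using assms(3)[of z] cnt_le_card[OF assms(1), of z] by simp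
qed

lemma cnt_eqI: assumes "\<And>z. cnt P z = cnt Q z" shows "P = Q"
proof (rule set_eqI)
  fix x show "x \<in> P \<longleftrightarrow> x \<in> Q"
    using assms[of x] assms[of "Suc x"] by (simp add: cnt_Suc split: if_splits)
qed

lemma cnt_surj: "n < cnt P z \<Longrightarrow> \<exists>u\<in>P. u < z \<and> cnt P u = n"
proof (induction z)
  case (Suc z)
  show ?case
  proof (cases "n < cnt P z")
    case True
    then show ?thesis using Suc.IH less_Suc_eq by blast
  next
    case False
    then show ?thesis using Suc.prems by (auto simp: cnt_Suc split: if_splits)
  qed
qed simp

lemma cnt_pred: "0 < cnt Q w \<Longrightarrow> \<exists>y\<in>Q. y < w \<and> Suc (cnt Q y) = cnt Q w"
  using cnt_surj[of "cnt Q w - 1" Q w] by auto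

lemma cnt_range: "finite P \<Longrightarrow> cnt P ` P = {..<card P}"
proof (intro equalityI subsetI)
  assume f: "finite P"
  fix n assume "n \<in> {..<card P}"
  then obtain z where "n < cnt P z" using card_le_cnt[OF f] by (metis lessThan_iff order_refl)
  then show "n \<in> cnt P ` P" using cnt_surj by blast
next
  assume f: "finite P"
  fix n assume "n \<in> cnt P ` P"
  then obtain u where u: "u \<in> P" "n = cnt P u" by blast
  then have "n < cnt P (Suc u)" by (simp add: cnt_Suc)
  then show "n \<in> {..<card P}" using cnt_le_card[OF f, of "Suc u"] by simp
qed

text \<open>When \<open>x\<close> is removed from the column \<open>P\<close>, the hole slides down and \<open>y\<close> is the entry of the
  next column \<open>Q\<close> that moves left into it.\<close>

definition crosses :: "nat set \<Rightarrow> nat set \<Rightarrow> nat \<Rightarrow> nat \<Rightarrow> bool" where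
  "crosses P Q x y \<longleftrightarrow> y \<in> Q \<and> cnt P x \<le> cnt Q y \<and> cnt P (Suc y) \<le> Suc (cnt Q y) \<and>
     (\<forall>z\<in>Q. z < y \<longrightarrow> cnt P x \<le> cnt Q z \<longrightarrow> Suc (cnt Q z) < cnt P (Suc z))"

lemma crosses_unique: "crosses P Q x y \<Longrightarrow> crosses P Q x y' \<Longrightarrow> y = y'"
  unfolding crosses_def by (metis linorder_neqE_nat not_less)

text \<open>Without minimality, the conditions say that \<open>y\<close> lies at or below the row of
  the hole and that the entry of \<open>P\<close> one row further down, if any, exceeds
  \<open>y\<close>. The least such entry is where the hole leaves the column.\<close>

lemma crosses_exists:
  assumes "y \<in> Q" "cnt P x \<le> cnt Q y" "cnt P (Suc y) \<le> Suc (cnt Q y)"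
  shows "\<exists>y'\<le>y. crosses P Q x y'"
proof -
  let ?R = "\<lambda>y. y \<in> Q \<and> cnt P x \<le> cnt Q y \<and> cnt P (Suc y) \<le> Suc (cnt Q y)"
  have "?R (LEAST y. ?R y)" by (rule LeastI[of ?R y]) (use assms in blast)
  moreover have "(LEAST y. ?R y) \<le> y" by (rule Least_le) (use assms in blast)
  moreover have "\<not> ?R z" if "z < (LEAST y. ?R y)" for z using not_less_Least[OF that] .
  ultimately show ?thesis unfolding crosses_def by (meson not_less)
qed

text \<open>Since \<open>Q\<close> has at least as many entries below \<open>w\<close> as
  \<open>P\<close>, the last of them already meets the crossing condition: its row is at or below
  that of \<open>x\<close>, and the entry of \<open>P\<close> in the following row, if any, is at
  least \<open>w\<close>.\<close>

lemma crosses_below: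
  assumes "x \<in> P" "x < w" "cnt P w \<le> cnt Q w"
  shows "\<exists>y<w. crosses P Q x y"
proof -
  have 1: "cnt P x < cnt P w" using assms by (simp add: cnt_less)
  then obtain y where y: "y \<in> Q" "y < w" "Suc (cnt Q y) = cnt Q w"
    using cnt_pred[of Q w] assms(3) by auto
  have "cnt P (Suc y) \<le> cnt P w" using y by (simp add: cnt_mono)
  then obtain y' where "y' \<le> y" "crosses P Q x y'"
    using crosses_exists[of y Q P x] y 1 assms(3) by auto
  then show ?thesis using y(2) by (intro exI[of _ y']) simp
qed

context
  fixes P Q :: "nat set" and x y :: nat
  assumes le: "\<And>z. cnt Q z \<le> cnt P z" and x: "x \<in> P" and cr: "crosses P Q x y"
begin

text \<open>A crossing happens at a tie: interlacing squeezes the inequality in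
  \<open>crosses\<close>, so both columns have equally many entries up to and including
  \<open>y\<close>.\<close>

lemma crosses_count: "cnt P (Suc y) = Suc (cnt Q y)" "cnt Q (Suc y) = Suc (cnt Q y)"
  using cr le[of "Suc y"] by (auto simp: crosses_def cnt_Suc)

lemma crosses_ge: "x \<le> y"
proof (rule ccontr)
  assume "\<not> x \<le> y"
  then have "cnt P (Suc y) \<le> cnt P x" by (simp add: cnt_mono)
  then show False using crosses_count cr unfolding crosses_def by linarith
qed

text \<open>An entry of \<open>P\<close> equal to \<open>y\<close> would give
  \<open>cnt P y \<le> cnt Q y\<close>, so the hole would already have crossed below
  \<open>y\<close>. Hence the new column has no repeated entry.\<close>

lemma crosses_fresh: "y \<notin> P - {x}"
proof
  assume "y \<in> P - {x}"
  then have "y \<in> P" "x < y" using crosses_ge by auto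
  moreover have "cnt P y \<le> cnt Q y" using crosses_count \<open>y \<in> P\<close> by (simp add: cnt_Suc)
  ultimately show False using crosses_below[OF x] crosses_unique[OF cr] by blast
qed

lemma crosses_cnt:
  "cnt (insert y (P - {x})) z = (if x < z \<and> z \<le> y then cnt P z - 1 else cnt P z)"
  using cnt_insert[OF crosses_fresh, of z] cnt_remove[OF x, of z] crosses_ge by auto

text \<open>Left behind by the slide, this tie is the barrier that keeps the next slide below
  \<open>y\<close>.\<close>

lemma crosses_level: "cnt (insert y (P - {x})) y = cnt Q y"
  using crosses_cnt[of y] crosses_count(1) crosses_fresh crosses_ge x
  by (auto simp: cnt_Suc split: if_splits)

end

text \<open>The contrapositive of \<open>crosses_below\<close>: as long as the hole has not crossed,
  the left column has an entry to spare, so deleting \<open>x\<close> preserves interlacing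
  there.\<close>

lemma no_crossing_between:
  assumes "\<And>z. cnt Q z \<le> cnt P z" "x \<in> P" "\<And>y. crosses P Q x y \<Longrightarrow> z \<le> y" "x < z"
  shows "cnt Q z < cnt P z"
proof (rule ccontr)
  assume "\<not> ?thesis"
  then have "cnt P z \<le> cnt Q z" by simp
  then show False using crosses_below[OF assms(2,4)] assms(3) by fastforce
qed

section \<open>Slide paths through consecutive columns\<close>

definition chain :: "(nat \<Rightarrow> nat set) \<Rightarrow> nat \<Rightarrow> (nat \<Rightarrow> nat) \<Rightarrow> bool" where
  "chain P m y \<longleftrightarrow> y 0 \<in> P 0 \<and> (\<forall>k<m. crosses (P k) (P (Suc k)) (y k) (y (Suc k))) \<and>
     (\<nexists>z. crosses (P m) (P (Suc m)) (y m) z)"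

definition slide :: "(nat \<Rightarrow> nat set) \<Rightarrow> nat \<Rightarrow> (nat \<Rightarrow> nat) \<Rightarrow> nat \<Rightarrow> nat set" where
  "slide P m y k = (if k < m then insert (y (Suc k)) (P k - {y k})
     else if k = m then P k - {y k} else P k)"

text \<open>Weak increase along rows, stated through ranks: entry number \<open>i\<close> of column
  \<open>k\<close> exists and is at most entry number \<open>i\<close> of column
  \<open>Suc k\<close>.\<close>

definition interlaced :: "(nat \<Rightarrow> nat set) \<Rightarrow> bool" where
  "interlaced P \<longleftrightarrow> (\<forall>k z. cnt (P (Suc k)) z \<le> cnt (P k) z)"

text \<open>The hole of each slide is the largest virtual entry left, that is, the bottom box of the
  remaining inner column.\<close>

inductive rectifies :: "nat \<Rightarrow> (nat \<Rightarrow> nat set) \<Rightarrow> (nat \<Rightarrow> nat set) \<Rightarrow> bool" where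
  zero: "rectifies 0 P P"
| Suc: "chain P m y \<Longrightarrow> y 0 = s \<Longrightarrow> rectifies s (slide P m y) C \<Longrightarrow> rectifies (Suc s) P C"

lemma chain_mem: "chain P m y \<Longrightarrow> k \<le> m \<Longrightarrow> y k \<in> P k"
  by (cases k) (auto simp: chain_def crosses_def)

context
  fixes P m y
  assumes P: "interlaced P" and c: "chain P m y"
begin

lemma chain_crosses:
  assumes "k < m"
  shows "\<And>z. cnt (P (Suc k)) z \<le> cnt (P k) z" "y k \<in> P k"
    "crosses (P k) (P (Suc k)) (y k) (y (Suc k))"
  using assms P c chain_mem[OF c, of k] by (auto simp: interlaced_def chain_def)

lemma chain_step: "k < m \<Longrightarrow> y k \<le> y (Suc k)"
  using crosses_ge chain_crosses by metis

lemma chain_fresh: "k < m \<Longrightarrow> y (Suc k) \<notin> P k - {y k}"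
  using crosses_fresh chain_crosses by metis

lemma cnt_slide:
  "cnt (slide P m y k) z + (if k \<le> m \<and> y k < z then 1 else 0) =
     cnt (P k) z + (if k < m \<and> y (Suc k) < z then 1 else 0)"
  using cnt_remove[of "y k" "P k" z] chain_mem[OF c, of k] chain_fresh[of k]
    cnt_insert[of "y (Suc k)" "P k - {y k}" z]
  by (auto simp: slide_def)

lemma interlaced_slide: "interlaced (slide P m y)"
  unfolding interlaced_def
proof (intro allI)
  fix k z
  have le: "cnt (P (Suc k)) z \<le> cnt (P k) z" for z using P by (simp add: interlaced_def)
  have "cnt (P (Suc k)) z < cnt (P k) z" if "k \<le> m" "y k < z" "k < m \<longrightarrow> z \<le> y (Suc k)"
  proof (rule no_crossing_between[OF le chain_mem[OF c that(1)] _ that(2)])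
    fix u assume "crosses (P k) (P (Suc k)) (y k) u"
    then show "z \<le> u"
      using that c crosses_unique chain_def by (metis le_neq_implies_less)
  qed
  then show "cnt (slide P m y (Suc k)) z \<le> cnt (slide P m y k) z"
    using cnt_slide[of k z] cnt_slide[of "Suc k" z] le[of z] chain_step[of "Suc k"] chain_step[of k]
    by (auto split: if_splits)
qed

lemma slide_level: "k < m \<Longrightarrow> cnt (slide P m y k) (y (Suc k)) = cnt (slide P m y (Suc k)) (y (Suc k))"
  using crosses_level[OF chain_crosses(1) chain_crosses(2) chain_crosses(3), of k]
    cnt_slide[of "Suc k" "y (Suc k)"] chain_step[of "Suc k"]
  by (auto simp: slide_def split: if_splits)

text \<open>At a level with tied counts the hole must cross below that level, by
  \<open>crosses_below\<close>; so the path stays under \<open>W\<close> and cannot stop before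
  column \<open>l\<close>.\<close>

lemma chain_below:
  assumes "y 0 < W 0"
    and W: "\<And>k. k < l \<Longrightarrow> W k \<le> W (Suc k) \<and> cnt (P k) (W (Suc k)) = cnt (P (Suc k)) (W (Suc k))"
  shows "k \<le> l \<Longrightarrow> k \<le> m \<and> y k < W k"
proof (induction k)
  case (Suc k)
  then have k: "k \<le> m" "y k < W (Suc k)" using W[of k] by auto
  then obtain u where u: "u < W (Suc k)" "crosses (P k) (P (Suc k)) (y k) u"
    using crosses_below[OF chain_mem[OF c k(1)] k(2)] W[of k] Suc.prems by (metis Suc_le_eq order_refl)
  then have "k < m" using c k(1) by (auto simp: chain_def order_le_less)
  then have "y (Suc k) = u" using crosses_unique u(2) chain_crosses(3) by blast
  then show ?case using u \<open>k < m\<close> by simp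
qed (use assms in simp)

end

text \<open>If \<open>A\<close> and \<open>B\<close> have equal size, this says that \<open>A\<close> is the set of elements of \<open>A \<union> X\<close> that get
  used when each element of \<open>B\<close> in turn, in any order, picks the largest unused one below or equal
  to it.\<close>

definition matching :: "nat set \<Rightarrow> nat set \<Rightarrow> nat set \<Rightarrow> bool" where
  "matching A X B \<longleftrightarrow> A \<inter> X = {} \<and> B \<inter> X = {} \<and> (\<forall>z. cnt B z \<le> cnt A z) \<and>
     (\<forall>y\<in>X. cnt A y = cnt B y)"

text \<open>\<open>X k\<close> collects the entries that leave column \<open>k\<close> to the left. The last conjunct is the
  non-crossing property of successive slides: a slide leaves at \<open>W (Suc k)\<close> a level up to which
  columns \<open>k\<close> and \<open>Suc k\<close> have equally many entries, and this forces every later slide to pass from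
  column \<open>Suc k\<close> to column \<open>k\<close> below it.\<close>

lemma rectifies_matching:
  assumes "rectifies s P C" "interlaced P" "{..<s} \<subseteq> P 0"
  shows "\<exists>X. X 0 = {..<s} \<and>
    (\<forall>k. X k \<subseteq> P k \<and> matching (P k - X k) (X (Suc k)) (P (Suc k) - X (Suc k)) \<and>
         C k = (P k - X k) \<union> X (Suc k)) \<and>
    (\<forall>W l. s \<le> W 0 \<longrightarrow>
       (\<forall>k<l. W k \<le> W (Suc k) \<and> cnt (P k) (W (Suc k)) = cnt (P (Suc k)) (W (Suc k))) \<longrightarrow>
       (\<forall>k\<le>l. finite (X k) \<and> card (X k) = s \<and> X k \<subseteq> {..<W k}))"
  using assms
proof (induction rule: rectifies.induct)
  case (zero P)
  show ?case
    by (rule exI[of _ "\<lambda>_. {}"]) (use zero in \<open>simp add: matching_def interlaced_def\<close>)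
next
  case (Suc P m y s C)
  note P = Suc.prems(1) and c = Suc.hyps(1) and y0 = Suc.hyps(2)
  let ?P = "slide P m y"
  note step = chain_step[OF P c] and fresh = chain_fresh[OF P c] and mem = chain_mem[OF c]
  have "{..<s} \<subseteq> ?P 0"
    using Suc.prems(2) y0 by (auto simp: slide_def)
  note IH = Suc.IH[OF interlaced_slide[OF P c] this]
  obtain X' where IH': "X' 0 = {..<s} \<and>
    (\<forall>k. X' k \<subseteq> ?P k \<and> matching (?P k - X' k) (X' (Suc k)) (?P (Suc k) - X' (Suc k)) \<and>
         C k = (?P k - X' k) \<union> X' (Suc k)) \<and>
    (\<forall>W l. s \<le> W 0 \<longrightarrow>
       (\<forall>k<l. W k \<le> W (Suc k) \<and> cnt (?P k) (W (Suc k)) = cnt (?P (Suc k)) (W (Suc k))) \<longrightarrow>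
       (\<forall>k\<le>l. finite (X' k) \<and> card (X' k) = s \<and> X' k \<subseteq> {..<W k}))"
    using IH by (rule exE)
  then have X0: "X' 0 = {..<s}"
    and sub': "\<And>k. X' k \<subseteq> ?P k"
    and M': "\<And>k. matching (?P k - X' k) (X' (Suc k)) (?P (Suc k) - X' (Suc k))"
    and C': "\<And>k. C k = (?P k - X' k) \<union> X' (Suc k)"
    by simp_all
  \<comment> \<open>The path \<open>y\<close> itself serves as the barrier \<open>W\<close>: by
    \<open>slide_level\<close> it leaves ties behind, so the remaining \<open>s\<close> slides take
    \<open>s\<close> entries below \<open>y k\<close> from each column
    \<open>k \<le> m\<close>.\<close>
  have "\<forall>k\<le>m. finite (X' k) \<and> card (X' k) = s \<and> X' k \<subseteq> {..<y k}"
    using IH'[THEN conjunct2, THEN conjunct2, rule_format, of y m] y0 step slide_level[OF P c]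
    by simp
  then have fin': "finite (X' k)" and card': "card (X' k) = s" and less': "u \<in> X' k \<Longrightarrow> u < y k"
    if "k \<le> m" for k u using that by auto
  define X where "X k = (if k \<le> m then insert (y k) (X' k) else X' k)" for k
  define A where "A k = P k - X k" for k
  have yX': "y k \<notin> X' k" if "k \<le> m" for k using less'[OF that] by blast
  have ySX': "y (Suc k) \<notin> X' k" if "k < m" for k using less'[of k] step[OF that] that by fastforce
  have finX: "finite (X k)" and cardX: "card (X k) = Suc s" and leX: "u \<in> X k \<Longrightarrow> u \<le> y k"
    if "k \<le> m" for k u
    using that fin' card' yX' less' by (auto simp: X_def less_imp_le)
  have subX: "X k \<subseteq> P k" for k
    using sub'[of k] ySX'[of k] mem[of k] by (auto simp: X_def slide_def split: if_splits)
  have A': "?P k - X' k = (if k < m then insert (y (Suc k)) (A k) else A k)" for k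
    using ySX'[of k] yX'[of k] by (auto simp: A_def X_def slide_def)
  have yA: "y (Suc k) \<notin> A k" if "k < m" for k
    using fresh[OF that] that by (auto simp: A_def X_def)
  have cntA': "cnt (?P k - X' k) z = cnt (A k) z + (if k < m \<and> y (Suc k) < z then 1 else 0)" for k z
    using cnt_insert[OF yA, of k z] A'[of k] by auto
  have above: "cnt (A k) z = cnt (P k) z - Suc s" if "k \<le> m" "y k < z" for k z
  proof -
    have "cnt (X k) z = Suc s"
      using cnt_eq_card[of "X k" z] cardX leX that by fastforce
    then show ?thesis using cnt_Diff[OF subX, of k z] by (simp add: A_def)
  qed
  \<comment> \<open>Above \<open>y (Suc k)\<close> all \<open>Suc s\<close> departing entries of
    both columns are counted, so the inequality for \<open>P\<close> carries over; elsewhere the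
    induction hypothesis applies.\<close>
  have ge: "cnt (A (Suc k)) z \<le> cnt (A k) z" for k z
  proof (cases "k < m \<and> y (Suc k) < z")
    case True
    then have "y k < z" using step[of k] by simp
    moreover have "cnt (P (Suc k)) z \<le> cnt (P k) z" using P by (simp add: interlaced_def)
    ultimately show ?thesis using True above[of k z] above[of "Suc k" z] by simp
  next
    case False
    have "cnt (?P (Suc k) - X' (Suc k)) z \<le> cnt (?P k - X' k) z"
      using M'[of k] by (simp add: matching_def)
    then show ?thesis using cntA'[of k z] cntA'[of "Suc k" z] False by (simp split: if_splits)
  qed
  have lev: "cnt (A k) u = cnt (A (Suc k)) u" if "u \<in> X (Suc k)" for k u
  proof (cases "u \<in> X' (Suc k)")
    case True
    then have eq: "cnt (?P k - X' k) u = cnt (?P (Suc k) - X' (Suc k)) u"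
      using M'[of k] by (simp add: matching_def)
    show ?thesis
    proof (cases "k < m")
      case True
      then have "u < y (Suc k)" using less'[of "Suc k"] \<open>u \<in> X' (Suc k)\<close> by simp
      then show ?thesis using eq cntA'[of k u] cntA'[of "Suc k" u] step[of "Suc k"]
        by (auto split: if_splits)
    next
      case False
      then show ?thesis using eq cntA'[of k u] cntA'[of "Suc k" u] by simp
    qed
  next
    case False
    then have u: "u = y (Suc k)" "k < m" using that by (auto simp: X_def split: if_splits)
    \<comment> \<open>For the new entry the tie comes from the crossing itself. Subtracting the
      \<open>Suc s\<close> departing entries on both sides leaves a tie just above \<open>u\<close>,
      which neither \<open>A k\<close> nor \<open>A (Suc k)\<close> contains.\<close>
    have "cnt (P k) (Suc u) = cnt (P (Suc k)) (Suc u)"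
      using crosses_count[OF chain_crosses[OF P c u(2)]] u by simp
    then have "cnt (A k) (Suc u) = cnt (A (Suc k)) (Suc u)"
      using above[of k "Suc u"] above[of "Suc k" "Suc u"] u step[OF u(2)] by simp
    moreover have "u \<notin> A k" "u \<notin> A (Suc k)"
      using yA[of k] u that by (auto simp: A_def)
    ultimately show ?thesis by (simp add: cnt_Suc)
  qed
  have disj: "A k \<inter> X (Suc k) = {}" for k
  proof -
    have "A k \<subseteq> ?P k - X' k" unfolding A' by auto
    then have "A k \<inter> X' (Suc k) = {}" using M'[of k] unfolding matching_def by blast
    then show ?thesis using yA[of k] unfolding X_def by (simp add: Suc_le_eq)
  qed
  have "X 0 = {..<Suc s}" by (simp add: X_def X0 y0 lessThan_Suc)
  moreover have "\<forall>k. X k \<subseteq> P k \<and> matching (P k - X k) (X (Suc k)) (P (Suc k) - X (Suc k)) \<and>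
         C k = (P k - X k) \<union> X (Suc k)"
  proof
    fix k
    have "C k = A k \<union> X (Suc k)" unfolding C' A' by (simp add: X_def Suc_le_eq)
    moreover have "matching (A k) (X (Suc k)) (A (Suc k))"
      using disj[of k] ge lev by (auto simp: matching_def A_def)
    ultimately show "X k \<subseteq> P k \<and> matching (P k - X k) (X (Suc k)) (P (Suc k) - X (Suc k)) \<and>
         C k = (P k - X k) \<union> X (Suc k)"
      using subX by (simp add: A_def)
  qed
  moreover have "\<forall>W l. Suc s \<le> W 0 \<longrightarrow>
       (\<forall>k<l. W k \<le> W (Suc k) \<and> cnt (P k) (W (Suc k)) = cnt (P (Suc k)) (W (Suc k))) \<longrightarrow>
       (\<forall>k\<le>l. finite (X k) \<and> card (X k) = Suc s \<and> X k \<subseteq> {..<W k})"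
  proof (intro allI impI)
    fix W :: "nat \<Rightarrow> nat" and l k
    assume W: "Suc s \<le> W 0"
      "\<forall>k<l. W k \<le> W (Suc k) \<and> cnt (P k) (W (Suc k)) = cnt (P (Suc k)) (W (Suc k))"
      and "k \<le> l"
    have "y 0 < W 0" using W(1) y0 by simp
    then have k: "k \<le> m" "y k < W k"
      using chain_below[OF P c, of W l, OF _ W(2)[rule_format] \<open>k \<le> l\<close>] by simp_all
    then have "X k \<subseteq> {..<W k}" using leX[OF k(1)] by (auto intro: le_less_trans)
    then show "finite (X k) \<and> card (X k) = Suc s \<and> X k \<subseteq> {..<W k}"
      using finX[OF k(1)] cardX[OF k(1)] by simp
  qed
  ultimately show ?case by (intro exI[of _ X] conjI)
qed

section \<open>Uniqueness of the matching\<close>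

text \<open>At an element of \<open>X\<close> the counts of \<open>A\<close> and \<open>B\<close>
  agree, so the hypothesis reduces there to the claim. Between elements of \<open>X\<close> the
  function \<open>cnt X\<close> is constant, so \<open>z\<close> may be raised to the next one; past
  the last one the cardinalities decide.\<close>

lemma matching_cnt_le:
  assumes M: "matching A X B"
    and le: "\<And>z. cnt B z + cnt X' z \<le> cnt A z + cnt X z"
    and X: "finite X" "finite X'" "card X' \<le> card X"
  shows "cnt X' z \<le> cnt X z"
proof (cases "\<exists>y\<in>X. z \<le> y")
  case True
  define y where "y = (LEAST y. y \<in> X \<and> z \<le> y)"
  have y: "y \<in> X" "z \<le> y" using LeastI_ex[of "\<lambda>y. y \<in> X \<and> z \<le> y"] True by (auto simp: y_def)
  have "X \<inter> {..<y} = X \<inter> {..<z}"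
    using y(2) not_less_Least[of _ "\<lambda>y. y \<in> X \<and> z \<le> y"] by (force simp: y_def)
  then have "cnt X y = cnt X z" by (simp add: cnt_def)
  moreover have "cnt A y = cnt B y" using M y by (simp add: matching_def)
  ultimately have "cnt X' y \<le> cnt X z" using le[of y] by simp
  then show ?thesis using cnt_mono[OF y(2), of X'] by simp
next
  case False
  then have "cnt X z = card X" by (intro cnt_eq_card) auto
  then show ?thesis using cnt_le_card[OF X(2), of z] X(3) by simp
qed

lemma matching_unique:
  assumes M: "matching A X B" "matching A' X' B"
    and eq: "A \<union> X = A' \<union> X'" and "finite A" "finite X" "finite A'" "finite X'"
    and card: "card A = card A'"
  shows "A = A'"
proof -
  have d: "A \<inter> X = {}" "A' \<inter> X' = {}" using M by (simp_all add: matching_def)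
  have "card X = card X'"
    using card card_Un_disjoint[OF assms(4,5) d(1)] card_Un_disjoint[OF assms(6,7) d(2)] eq by simp
  moreover have "cnt A z + cnt X z = cnt A' z + cnt X' z" for z
    using cnt_Un[OF d(1)] cnt_Un[OF d(2)] eq by simp
  moreover have "cnt B z \<le> cnt A z" "cnt B z \<le> cnt A' z" for z
    using M by (simp_all add: matching_def)
  ultimately have "cnt X z = cnt X' z" for z
    by (intro antisym matching_cnt_le[OF M(1)] matching_cnt_le[OF M(2)])
      (metis add_le_mono1 add.commute assms(5,7) order_refl)+
  then have "X = X'" by (rule cnt_eqI)
  then show ?thesis using d eq by blast
qed

section \<open>Slide sequences recovered from matchings\<close>

lemma chain_exists:
  assumes "x \<in> P 0" "P c = {}"
  shows "\<exists>m y. chain P m y \<and> y 0 = x"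
proof -
  define y where "y = rec_nat x (\<lambda>k u. SOME v. crosses (P k) (P (Suc k)) u v)"
  let ?stop = "\<lambda>k. \<nexists>v. crosses (P k) (P (Suc k)) (y k) v"
  have "\<exists>k. ?stop k"
  proof (cases c)
    case 0
    then show ?thesis using assms by simp
  next
    case (Suc k)
    then show ?thesis using assms(2) by (auto simp: crosses_def)
  qed
  then have "?stop (LEAST k. ?stop k)" by (rule LeastI_ex)
  moreover have "crosses (P k) (P (Suc k)) (y k) (y (Suc k))" if "k < (LEAST k. ?stop k)" for k
    using not_less_Least[OF that] someI_ex[of "crosses (P k) (P (Suc k)) (y k)"]
    by (simp add: y_def)
  moreover have "y 0 = x" by (simp add: y_def)
  ultimately have "chain P (LEAST k. ?stop k) y \<and> y 0 = x"
    using assms(1) unfolding chain_def by simp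
  then show ?thesis by blast
qed

text \<open>The converse of \<open>rectifies_matching\<close>: the departing entries
  \<open>X\<close> are prescribed and the slides are recovered from them. As slides do not cross,
  the first one takes the largest element of each \<open>X k\<close> on its way.\<close>

lemma matching_rectifies:
  assumes "\<And>k. matching (A k) (X (Suc k)) (A (Suc k))" "A 0 \<inter> X 0 = {}"
    "\<And>k z. cnt (X (Suc k)) z \<le> cnt (X k) z" "\<And>k. finite (X k)" "X c = {}" "X 0 = {..<s}"
  shows "rectifies s (\<lambda>k. A k \<union> X k) (\<lambda>k. A k \<union> X (Suc k))"
  using assms
proof (induction s arbitrary: A X)
  case 0
  have "cnt (X k) z = 0" for k z
  proof (induction k)
    case (Suc k)
    then show ?case using 0(3)[of k z] by simp
  qed (simp add: 0)
  then have "X k = {}" for k by (intro cnt_eqI) simp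
  then show ?case using rectifies.zero by simp
next
  case (Suc s)
  note M = Suc.prems(1) and X_le = Suc.prems(3) and fin = Suc.prems(4)
  \<comment> \<open>The first slide goes on while all \<open>Suc s\<close> slides take an entry from
    the column; \<open>m\<close> is the last column of that initial run.\<close>
  define m where "m = (LEAST k. card (X (Suc k)) < Suc s)"
  have card_le: "card (X (Suc k)) \<le> card (X k)" for k
    using cnt_leD_card[OF fin fin] X_le by blast
  have "card (X c) < Suc s" using Suc.prems(5) by simp
  moreover have "c \<noteq> 0" using Suc.prems(5,6) by (cases c) auto
  ultimately have "\<exists>k. card (X (Suc k)) < Suc s" by (metis not0_implies_Suc)
  then have m: "card (X (Suc m)) < Suc s" unfolding m_def by (rule LeastI_ex)
  have card_le_s: "card (X k) \<le> Suc s" for k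
  proof (induction k)
    case (Suc k)
    then show ?case using card_le[of k] by simp
  qed (simp add: Suc.prems)
  have card_eq: "card (X k) = Suc s" if "k \<le> m" for k
  proof (cases k)
    case (Suc l)
    then have "l < m" using that by simp
    then show ?thesis using not_less_Least[of l] card_le_s[of k] Suc by (fastforce simp: m_def)
  qed (simp add: Suc.prems)
  define y where "y k = Max (X k)" for k
  have y: "y k \<in> X k" "u \<in> X k \<Longrightarrow> u \<le> y k" if "k \<le> m" for k u
  proof -
    have "X k \<noteq> {}" using card_eq[OF that] by auto
    then show "y k \<in> X k" "u \<in> X k \<Longrightarrow> u \<le> y k" using fin by (simp_all add: y_def)
  qed
  have cnt_top: "cnt (X k) z = Suc s" if "k \<le> m" "y k < z" for k z
  proof -
    have "X k \<subseteq> {..<z}" using y(2)[OF that(1)] that(2) by (auto intro: le_less_trans)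
    then show ?thesis using cnt_eq_card card_eq[OF that(1)] by simp
  qed
  have cnt_low: "cnt (X k) z \<le> s" if "k \<le> m \<longrightarrow> z \<le> y k" "k \<le> Suc m" for k z
  proof (cases "k \<le> m")
    case True
    have "cnt (X k) z \<le> cnt (X k) (y k)" using that True by (intro cnt_mono) simp
    then show ?thesis using cnt_top[OF True, of "Suc (y k)"] y(1)[OF True] by (simp add: cnt_Suc)
  next
    case False
    then have "k = Suc m" using that(2) by simp
    then show ?thesis using cnt_le_card[OF fin, of k z] m by simp
  qed
  have step: "y k \<le> y (Suc k)" if "k < m" for k
  proof (rule ccontr)
    assume "\<not> ?thesis"
    then have "cnt (X (Suc k)) (y k) = Suc s" using cnt_top[of "Suc k" "y k"] that by simp
    then show False using X_le[of k "y k"] cnt_low[of k "y k"] that by simp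
  qed
  let ?P = "\<lambda>k. A k \<union> X k"
  have disj: "A k \<inter> X k = {}" for k
    using M[of "k - 1"] Suc.prems(2) by (cases k) (auto simp: matching_def)
  have cntP: "cnt (?P k) z = cnt (A k) z + cnt (X k) z" for k z by (rule cnt_Un[OF disj])
  have A_le: "cnt (A (Suc k)) z \<le> cnt (A k) z" for k z using M[of k] by (simp add: matching_def)
  \<comment> \<open>No candidate before \<open>y (Suc k)\<close> can cross: up to there
    \<open>X (Suc k)\<close> counts at most \<open>s\<close>, while \<open>X k\<close> counts
    \<open>Suc s\<close> beyond \<open>y k\<close>. A candidate below \<open>y k\<close> would lie
    above the row of the hole.\<close>
  have key: "Suc (cnt (?P (Suc k)) z) < cnt (?P k) (Suc z)"
    if "k \<le> m" "z \<in> ?P (Suc k)" "k < m \<longrightarrow> z < y (Suc k)" "cnt (?P k) (y k) \<le> cnt (?P (Suc k)) z"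
    for k z
  proof -
    have "cnt (X (Suc k)) (Suc z) \<le> s" by (rule cnt_low) (use that in auto)
    then have Q: "Suc (cnt (?P (Suc k)) z) \<le> cnt (A k) (Suc z) + s"
      using A_le[of k "Suc z"] that(2) cntP[of "Suc k" "Suc z"] by (simp add: cnt_Suc)
    show ?thesis
    proof (cases "y k \<le> z")
      case True
      then show ?thesis using Q cntP[of k "Suc z"] cnt_top[of k "Suc z"] that(1) by simp
    next
      case False
      then have "cnt (A k) (Suc z) \<le> cnt (A k) (y k)" by (intro cnt_mono) simp
      moreover have "cnt (X k) (y k) = s"
        using cnt_top[of k "Suc (y k)"] y(1)[of k] that(1) by (simp add: cnt_Suc)
      ultimately show ?thesis using Q that(4) cntP[of k "y k"] by simp
    qed
  qed
  have cr: "crosses (?P k) (?P (Suc k)) (y k) (y (Suc k))" if "k < m" for k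
  proof -
    let ?y = "y (Suc k)"
    have mem: "?y \<in> X (Suc k)" using y(1) that by simp
    then have eq: "cnt (A k) ?y = cnt (A (Suc k)) ?y" "?y \<notin> A k"
      using M[of k] by (auto simp: matching_def)
    have "cnt (X (Suc k)) ?y = s" "cnt (X k) (y k) = s" "cnt (X k) (Suc ?y) = Suc s"
      using cnt_top[of "Suc k" "Suc ?y"] cnt_top[of k "Suc (y k)"] cnt_top[of k "Suc ?y"]
        y(1)[of k] mem that step[OF that] by (simp_all add: cnt_Suc)
    moreover have "cnt (A k) (y k) \<le> cnt (A k) ?y" using step[OF that] by (rule cnt_mono)
    ultimately have "cnt (?P k) (y k) \<le> cnt (?P (Suc k)) ?y"
      "cnt (?P k) (Suc ?y) \<le> Suc (cnt (?P (Suc k)) ?y)"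
      using eq by (simp_all only: cntP) (simp_all add: cnt_Suc)
    then show ?thesis unfolding crosses_def using key[of k] mem that by simp
  qed
  have "\<not> crosses (?P m) (?P (Suc m)) (y m) z" for z
    using key[of m z] by (auto simp: crosses_def)
  moreover have c0: "y 0 = s" unfolding y_def Suc.prems(6) by (rule Max_eqI) auto
  moreover have "y 0 \<in> ?P 0" using y(1)[of 0] by simp
  ultimately have c: "chain ?P m y"
    unfolding chain_def using cr by blast
  \<comment> \<open>After the first slide \<open>y (Suc k)\<close> sits in column \<open>k\<close>
    for good, so it passes from \<open>X (Suc k)\<close> to \<open>A k\<close>; the final columns
    \<open>A k \<union> X (Suc k)\<close> are unchanged.\<close>
  define A' where "A' k = (if k < m then insert (y (Suc k)) (A k) else A k)" for k
  define X' where "X' k = (if k \<le> m then X k - {y k} else X k)" for k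
  have yA: "y (Suc k) \<notin> A k" if "k < m" for k
    using y(1)[of "Suc k"] that M[of k] by (auto simp: matching_def)
  have cntA': "cnt (A' k) z = cnt (A k) z + (if k < m \<and> y (Suc k) < z then 1 else 0)" for k z
    using cnt_insert[OF yA, of k z] by (simp add: A'_def)
  have cntX': "cnt (X k) z = cnt (X' k) z + (if k \<le> m \<and> y k < z then 1 else 0)" for k z
    using cnt_remove[OF y(1), of k z] by (simp add: X'_def)
  have disj': "A' k \<inter> X' k = {}" for k
  proof -
    have "y (Suc k) \<notin> X' k" if "k < m"
      using y(2)[of k "y (Suc k)"] step[OF that] that by (auto simp: X'_def)
    then show ?thesis using disj[of k] by (auto simp: A'_def X'_def)
  qed
  have "rectifies s (\<lambda>k. A' k \<union> X' k) (\<lambda>k. A' k \<union> X' (Suc k))"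
  proof (rule Suc.IH)
    fix k
    have "A k \<inter> X (Suc k) = {}" using M[of k] by (simp add: matching_def)
    then have "A' k \<inter> X' (Suc k) = {}" by (auto simp: A'_def X'_def)
    moreover note disj'[of "Suc k"]
    moreover have "cnt (A' (Suc k)) z \<le> cnt (A' k) z" for z
      using A_le[of k z] step[of "Suc k"] by (auto simp: cntA')
    moreover have "cnt (A' k) u = cnt (A' (Suc k)) u" if "u \<in> X' (Suc k)" for u
    proof -
      have "u \<in> X (Suc k)" using that by (auto simp: X'_def split: if_splits)
      then have "cnt (A k) u = cnt (A (Suc k)) u" using M[of k] by (simp add: matching_def)
      moreover have "u \<le> y (Suc k)" if "k < m" using y(2)[of "Suc k" u] that \<open>u \<in> X (Suc k)\<close> by simp
      ultimately show ?thesis using step[of "Suc k"] by (auto simp: cntA')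
    qed
    ultimately show "matching (A' k) (X' (Suc k)) (A' (Suc k))" by (simp add: matching_def)
    fix z
    have "cnt (X' (Suc k)) z \<le> s" if "k \<le> m" "y k < z"
    proof (cases "Suc k \<le> m \<and> y (Suc k) < z")
      case True
      then show ?thesis using cnt_top[of "Suc k" z] cntX'[of "Suc k" z] by simp
    next
      case False
      then have "cnt (X (Suc k)) z \<le> s" using that by (intro cnt_low) auto
      then show ?thesis using cntX'[of "Suc k" z] by simp
    qed
    then show "cnt (X' (Suc k)) z \<le> cnt (X' k) z"
      using X_le[of k z] cntX'[of k z] cntX'[of "Suc k" z] cnt_top[of k z]
      by (auto split: if_splits)
    show "finite (X' k)" using fin by (simp add: X'_def)
  next
    show "A' 0 \<inter> X' 0 = {}" by (rule disj')
    show "X' c = {}" using Suc.prems(5) by (simp add: X'_def)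
    show "X' 0 = {..<s}" unfolding X'_def Suc.prems(6) c0 by auto
  qed
  moreover have "slide ?P m y = (\<lambda>k. A' k \<union> X' k)"
  proof
    fix k
    have "y k \<notin> A k" if "k \<le> m" using y(1)[OF that] disj[of k] by blast
    then show "slide ?P m y k = A' k \<union> X' k" by (auto simp: slide_def A'_def X'_def)
  qed
  moreover have "(\<lambda>k. A' k \<union> X' (Suc k)) = (\<lambda>k. A k \<union> X (Suc k))"
  proof
    fix k
    show "A' k \<union> X' (Suc k) = A k \<union> X (Suc k)"
      using y(1)[of "Suc k"] by (auto simp: A'_def X'_def)
  qed
  ultimately have "rectifies s (slide ?P m y) (\<lambda>k. A k \<union> X (Suc k))" by (simp only:)
  then show ?case by (rule rectifies.Suc[OF c c0])
qed

section \<open>Jeu de taquin on fillings\<close>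

text \<open>Columns are indexed from 0 and all entries are shifted by \<open>N\<close>. Values below \<open>N\<close> in column 0 are
  virtual: they occupy the boxes of the removed inner column and do not appear in the filling.\<close>

definition fil :: "nat \<Rightarrow> (nat \<Rightarrow> nat set) \<Rightarrow> filling" where
  "fil N P = (\<lambda>(i, k).
     if 1 \<le> k \<and> (\<exists>v. v + N \<in> P (k - 1) \<and> i = Suc (cnt (P (k - 1)) (v + N)))
     then Some (THE v. v + N \<in> P (k - 1) \<and> i = Suc (cnt (P (k - 1)) (v + N))) else None)"

lemma fil_Suc: "fil N P (i, Suc k) = Some v \<longleftrightarrow> v + N \<in> P k \<and> i = Suc (cnt (P k) (v + N))"
proof -
  let ?R = "\<lambda>v. v + N \<in> P k \<and> i = Suc (cnt (P k) (v + N))"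
  have uniq: "v = v'" if "?R v" "?R v'" for v v'
    using cnt_inj[of "v + N" "P k" "v' + N"] that by simp
  have "(THE v. ?R v) = v" if "?R v" for v
    by (rule the_equality[of ?R, OF that uniq[OF _ that]])
  then show ?thesis by (auto simp: fil_def)
qed

lemma fil_0: "fil N P (i, 0) = None"
  by (simp add: fil_def)

lemma option_eqI: "(\<And>v. a = Some v \<longleftrightarrow> b = Some v) \<Longrightarrow> a = b"
  by (cases a; cases b) auto

lemma jdt_move_deterministic: "jdt_move a b \<Longrightarrow> jdt_move a c \<Longrightarrow> b = c"
  by (cases a b rule: jdt_move.cases; cases a c rule: jdt_move.cases) fastforce+

lemma jdt_move_final:
  assumes "T (Suc i, j) = None" "T (i, Suc j) = None"
  shows "\<not> jdt_move ((i, j), T) b"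
  using assms by (auto elim!: jdt_move.cases)

text \<open>Moves are deterministic and the end states admit none, so two complete runs coincide. A
  slide computed on column sets is therefore the only possible one.\<close>

lemma jdt_slide_unique:
  assumes "jdt_slide h T T'" "jdt_slide h T T''"
  shows "T' = T''"
proof -
  have conf: "b = c" if runs: "jdt_move\<^sup>*\<^sup>* a b" "jdt_move\<^sup>*\<^sup>* a c"
    and b: "\<And>d. \<not> jdt_move b d" and c: "\<And>d. \<not> jdt_move c d"
    for a b c
    using runs
  proof (induction rule: converse_rtranclp_induct)
    case base
    then show ?case using b by (metis converse_rtranclpE)
  next
    case (step y z)
    then obtain z' where "jdt_move y z'" "jdt_move\<^sup>*\<^sup>* z' c"
      using step.hyps(1) step.prems c by (metis b converse_rtranclpE)
    then show ?case using step jdt_move_deterministic by blast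
  qed
  obtain i j where 1: "jdt_move\<^sup>*\<^sup>* (h, T) ((i, j), T')" "T' (Suc i, j) = None" "T' (i, Suc j) = None"
    using assms(1) unfolding jdt_slide_def by blast
  obtain i' j' where 2: "jdt_move\<^sup>*\<^sup>* (h, T) ((i', j'), T'')" "T'' (Suc i', j') = None"
      "T'' (i', Suc j') = None"
    using assms(2) unfolding jdt_slide_def by blast
  have "((i, j), T') = ((i', j'), T'')"
    by (rule conf[OF 1(1) 2(1)]) (use 1 2 jdt_move_final in blast)+
  then show ?thesis by simp
qed

text \<open>The result of moving the hole down column \<open>k\<close> from row \<open>h\<close> to
  row \<open>r\<close>.\<close>

definition lift_column :: "filling \<Rightarrow> nat \<Rightarrow> nat \<Rightarrow> nat \<Rightarrow> filling" where
  "lift_column T k h r = (\<lambda>(i, k'). if k' = k \<and> h \<le> i \<and> i < r then T (Suc i, k)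
     else if k' = k \<and> i = r then None else T (i, k'))"

lemma lift_column_moves:
  assumes "h \<le> r" "T (h, k) = None"
    and "\<And>t. h \<le> t \<Longrightarrow> t < r \<Longrightarrow>
      \<exists>b. T (Suc t, k) = Some b \<and> (\<forall>a. T (t, Suc k) = Some a \<longrightarrow> b \<le> a)"
  shows "jdt_move\<^sup>*\<^sup>* ((h, k), T) ((r, k), lift_column T k h r)"
  using assms(1,3)
proof (induction r rule: dec_induct)
  case base
  have "lift_column T k h h = T" using assms(2) by (auto simp: lift_column_def fun_eq_iff)
  then show ?case by simp
next
  case (step r)
  obtain b where b: "T (Suc r, k) = Some b" "\<forall>a. T (r, Suc k) = Some a \<longrightarrow> b \<le> a"
    using step.prems[of r] step.hyps by auto
  have "jdt_move ((r, k), lift_column T k h r) ((Suc r, k),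
      (lift_column T k h r)((r, k) := Some b, (Suc r, k) := None))"
    by (rule jdt_move.up) (use b in \<open>auto simp: lift_column_def\<close>)
  also have "(lift_column T k h r)((r, k) := Some b, (Suc r, k) := None) = lift_column T k h (Suc r)"
    using b step.hyps by (auto simp: lift_column_def fun_eq_iff)
  finally have last: "jdt_move ((r, k), lift_column T k h r) ((Suc r, k), lift_column T k h (Suc r))" .
  have "jdt_move\<^sup>*\<^sup>* ((h, k), T) ((r, k), lift_column T k h r)"
    by (rule step.IH) (simp add: step.prems)
  then show ?case using last by (rule rtranclp.rtrancl_into_rtrancl)
qed

text \<open>The hole left by removing \<open>x\<close> from column \<open>k\<close>, the other boxes staying in place.\<close>

definition holed :: "nat \<Rightarrow> (nat \<Rightarrow> nat set) \<Rightarrow> nat \<Rightarrow> nat \<Rightarrow> cell \<times> filling" where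
  "holed N P k x = ((Suc (cnt (P k) x), Suc k), (fil N P)((Suc (cnt (P k) x), Suc k) := None))"

context
  fixes N :: nat and P :: "nat \<Rightarrow> nat set" and k x :: nat
  assumes le: "\<And>z. cnt (P (Suc k)) z \<le> cnt (P k) z" and x: "x \<in> P k"
    and real: "\<And>u. u \<in> P k \<Longrightarrow> x < u \<Longrightarrow> N \<le> u"
begin

lemma row_entry:
  assumes "cnt (P k) x < t" "t < cnt (P k) z"
  shows "\<exists>v. v + N \<in> P k \<and> v + N < z \<and> cnt (P k) (v + N) = t \<and>
    (snd (holed N P k x)) (Suc t, Suc k) = Some v"
proof -
  obtain u where u: "u \<in> P k" "u < z" "cnt (P k) u = t" using cnt_surj[OF assms(2)] by blast
  then have "x < u" using assms(1) cnt_mono[of u x "P k"] by (meson not_less)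
  then have "u - N + N = u" using real u(1) by simp
  then show ?thesis using u assms(1)
    by (intro exI[of _ "u - N"]) (simp add: holed_def fil_Suc)
qed

lemma right_entry:
  "(snd (holed N P k x)) (t, Suc (Suc k)) = Some a \<longleftrightarrow> a + N \<in> P (Suc k) \<and> t = Suc (cnt (P (Suc k)) (a + N))"
  by (simp add: holed_def fil_Suc)

lemma hole_crosses:
  assumes cr: "crosses (P k) (P (Suc k)) x y" and N: "\<And>u. u \<in> P (Suc k) \<Longrightarrow> N \<le> u"
  shows "jdt_move\<^sup>*\<^sup>* (holed N P k x) (holed N (P(k := insert y (P k - {x}))) (Suc k) y)"
proof -
  let ?h = "Suc (cnt (P k) x)" and ?r = "Suc (cnt (P (Suc k)) y)"
  let ?T = "snd (holed N P k x)"
  let ?L = "lift_column ?T (Suc k) ?h ?r"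
  note count = crosses_count[OF le x cr] and xy = crosses_ge[OF le x cr]
    and fresh = crosses_fresh[OF le x cr] and cnt' = crosses_cnt[OF le x cr]
  have hole: "((?h, Suc k), ?T) = holed N P k x" "?T (?h, Suc k) = None"
    by (simp_all add: holed_def)
  have y: "y \<in> P (Suc k)" "?h \<le> ?r" using cr by (auto simp: crosses_def)
  \<comment> \<open>Before row \<open>?r\<close> every right neighbour fails the crossing condition,
    which says exactly that the lower neighbour is no larger.\<close>
  have up: "\<exists>b. ?T (Suc t, Suc k) = Some b \<and> (\<forall>a. ?T (t, Suc (Suc k)) = Some a \<longrightarrow> b \<le> a)"
    if t: "?h \<le> t" "t < ?r" for t
  proof -
    obtain b where b: "b + N \<in> P k" "cnt (P k) (b + N) = t" "?T (Suc t, Suc k) = Some b"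
      using row_entry[of t "Suc y"] t count by auto
    have "b \<le> a" if "?T (t, Suc (Suc k)) = Some a" for a
    proof -
      have a: "a + N \<in> P (Suc k)" "t = Suc (cnt (P (Suc k)) (a + N))"
        using that right_entry by blast+
      then have "a + N < y" using t(2) cnt_less_iff[OF a(1), of y] by simp
      then have "t < cnt (P k) (Suc (a + N))" using cr a t(1) by (auto simp: crosses_def)
      then have "b + N < Suc (a + N)" using cnt_less_iff[OF b(1)] b(2) by simp
      then show "b \<le> a" by simp
    qed
    then show ?thesis using b by blast
  qed
  have down: "jdt_move\<^sup>*\<^sup>* (holed N P k x) ((?r, Suc k), ?L)"
    using lift_column_moves[OF y(2) hole(2) up] unfolding hole(1) .
  have left: "jdt_move ((?r, Suc k), ?L)
      ((?r, Suc (Suc k)), ?L((?r, Suc k) := Some (y - N), (?r, Suc (Suc k)) := None))"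
  proof (rule jdt_move.left)
    show "?L (?r, Suc (Suc k)) = Some (y - N)"
      using y N[of y] right_entry by (simp add: lift_column_def)
    \<comment> \<open>By \<open>count\<close>, ranks from \<open>?r\<close> on belong to entries
      exceeding \<open>y\<close>; this is the strict inequality that a move to the left
      demands.\<close>
    show "\<forall>b. ?L (Suc ?r, Suc k) = Some b \<longrightarrow> y - N < b"
    proof (intro allI impI)
      fix b assume "?L (Suc ?r, Suc k) = Some b"
      then have b: "b + N \<in> P k" "cnt (P k) (b + N) = ?r"
        by (auto simp: lift_column_def holed_def fil_Suc split: if_splits)
      then have "\<not> b + N < Suc y" using cnt_less_iff[OF b(1), of "Suc y"] count by simp
      then show "y - N < b" using N[of y] y by simp
    qed
  qed
  have "((?r, Suc (Suc k)), ?L((?r, Suc k) := Some (y - N), (?r, Suc (Suc k)) := None)) =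
      holed N (P(k := insert y (P k - {x}))) (Suc k) y" (is "(_, ?A) = ?B")
  proof -
    have "?A (i, k') = snd ?B (i, k')" for i k'
    proof (rule option_eqI)
      fix v
      consider "k' = 0" | "k' = Suc k" | l where "k' = Suc l" "l \<noteq> k" by (cases k') auto
      then show "?A (i, k') = Some v \<longleftrightarrow> snd ?B (i, k') = Some v"
      proof cases
        case 1
        then show ?thesis by (simp add: lift_column_def holed_def fil_0)
      next
        case 3
        then show ?thesis by (simp add: lift_column_def holed_def fil_Suc)
      next
        case 2
        let ?u = "v + N"
        have B: "snd ?B (i, k') = Some v \<longleftrightarrow>
            ?u \<in> insert y (P k - {x}) \<and> i = Suc (cnt (insert y (P k - {x})) ?u)"
          using 2 by (simp add: holed_def fil_Suc)
        have T: "?T (i, Suc k) = Some v \<longleftrightarrow> ?u \<in> P k - {x} \<and> i = Suc (cnt (P k) ?u)" for i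
          using x cnt_inj[of ?u "P k" x] by (auto simp: holed_def fil_Suc)
        have A: "?A (i, k') = Some v \<longleftrightarrow>
            (if i = ?r then ?u = y else if ?h \<le> i \<and> i < ?r then ?T (Suc i, Suc k) = Some v
             else ?T (i, Suc k) = Some v)"
          using 2 N[of y] y by (auto simp: lift_column_def)
        have c: "cnt (P k) ?u < cnt (P k) x \<longleftrightarrow> ?u < x" "cnt (P k) x < cnt (P k) ?u \<longleftrightarrow> x < ?u"
            "cnt (P k) ?u < ?r \<longleftrightarrow> ?u < Suc y" if "?u \<in> P k"
          using cnt_less_iff[OF that, of x] cnt_less_iff[OF x, of ?u]
            cnt_less_iff[OF that, of "Suc y"] count by simp_all
        \<comment> \<open>Apart from \<open>y\<close>, exactly the entries between \<open>x\<close>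
          and \<open>y\<close> lose one in rank, and they form the lifted segment of the
          column.\<close>
        show ?thesis
        proof (cases "?u = y")
          case True
          have "?u \<notin> P k - {x}" "cnt (insert y (P k - {x})) y = cnt (P (Suc k)) y"
            using True fresh crosses_level[OF le x cr] by auto
          then show ?thesis unfolding A B T using True by auto
        next
          case False
          then show ?thesis unfolding A B T cnt' using c xy y(2) by (cases "?u < x"; cases "?u < y") auto
        qed
      qed
    qed
    then have "?A = snd ?B" by (intro ext) (simp only: split_paired_all)
    then show ?thesis unfolding holed_def by simp
  qed
  with left have "jdt_move ((?r, Suc k), ?L) ?B" by (simp only:)
  with down show ?thesis by (rule rtranclp.rtrancl_into_rtrancl)
qed

lemma hole_stops:
  assumes stop: "\<And>y. \<not> crosses (P k) (P (Suc k)) x y" and fin: "finite (P k)"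
  shows "\<exists>i j. jdt_move\<^sup>*\<^sup>* (holed N P k x) ((i, j), fil N (P(k := P k - {x}))) \<and>
    fil N (P(k := P k - {x})) (Suc i, j) = None \<and> fil N (P(k := P k - {x})) (i, Suc j) = None"
proof -
  let ?h = "Suc (cnt (P k) x)" and ?r = "card (P k)"
  let ?T = "snd (holed N P k x)"
  have hole: "((?h, Suc k), ?T) = holed N P k x" "?T (?h, Suc k) = None"
    by (simp_all add: holed_def)
  obtain z0 where z0: "cnt (P k) z0 = ?r" using card_le_cnt[OF fin] by blast
  have top: "cnt (P k) z \<le> ?r" for z using cnt_le_card[OF fin] .
  have h: "?h \<le> ?r" using top[of "Suc x"] x by (simp add: cnt_Suc)
  have ahead: "Suc (cnt (P (Suc k)) z) < cnt (P k) (Suc z)"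
    if "z \<in> P (Suc k)" "cnt (P k) x \<le> cnt (P (Suc k)) z" for z
    using crosses_exists[OF that] stop by (meson not_less)
  have up: "\<exists>b. ?T (Suc t, Suc k) = Some b \<and> (\<forall>a. ?T (t, Suc (Suc k)) = Some a \<longrightarrow> b \<le> a)"
    if t: "?h \<le> t" "t < ?r" for t
  proof -
    obtain b where b: "b + N \<in> P k" "cnt (P k) (b + N) = t" "?T (Suc t, Suc k) = Some b"
      using row_entry[of t z0] t z0 by auto
    have "b \<le> a" if "?T (t, Suc (Suc k)) = Some a" for a
    proof -
      have a: "a + N \<in> P (Suc k)" "t = Suc (cnt (P (Suc k)) (a + N))"
        using that right_entry by blast+
      then have "t < cnt (P k) (Suc (a + N))" using ahead t(1) by auto
      then have "b + N < Suc (a + N)" using cnt_less_iff[OF b(1)] b(2) by simp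
      then show "b \<le> a" by simp
    qed
    then show ?thesis using b by blast
  qed
  let ?P = "P(k := P k - {x})"
  have cnt': "cnt (P k - {x}) z = (if x < z then cnt (P k) z - 1 else cnt (P k) z)" for z
    using cnt_remove[OF x, of z] by auto
  have below: "cnt (P k) u < ?r" if "u \<in> P k" for u
    using top[of "Suc u"] that by (simp add: cnt_Suc)
  have "lift_column ?T (Suc k) ?h ?r (i, k') = fil N ?P (i, k')" for i k'
  proof (rule option_eqI)
    fix v
    consider "k' = 0" | "k' = Suc k" | l where "k' = Suc l" "l \<noteq> k" by (cases k') auto
    then show "lift_column ?T (Suc k) ?h ?r (i, k') = Some v \<longleftrightarrow> fil N ?P (i, k') = Some v"
    proof cases
      case 1
      then show ?thesis by (simp add: lift_column_def holed_def fil_0)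
    next
      case 3
      then show ?thesis by (simp add: lift_column_def holed_def fil_Suc)
    next
      case 2
      let ?u = "v + N"
      have T: "?T (i, Suc k) = Some v \<longleftrightarrow> ?u \<in> P k - {x} \<and> i = Suc (cnt (P k) ?u)" for i
        using x cnt_inj[of ?u "P k" x] by (auto simp: holed_def fil_Suc)
      have c: "cnt (P k) ?u < cnt (P k) x \<longleftrightarrow> ?u < x" "cnt (P k) x < cnt (P k) ?u \<longleftrightarrow> x < ?u"
        "cnt (P k) ?u < ?r" if "?u \<in> P k"
        using cnt_less_iff[OF that, of x] cnt_less_iff[OF x, of ?u] below[OF that] by simp_all
      have A: "lift_column ?T (Suc k) ?h ?r (i, k') = Some v \<longleftrightarrow>
          i \<noteq> ?r \<and> (if ?h \<le> i \<and> i < ?r then ?T (Suc i, Suc k) = Some v else ?T (i, Suc k) = Some v)"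
        using 2 by (auto simp: lift_column_def)
      show ?thesis unfolding A T using 2 c h
        by (cases "?u < x"; cases "?u = x") (auto simp: fil_Suc cnt')
    qed
  qed
  then have L: "lift_column ?T (Suc k) ?h ?r = fil N ?P" by auto
  have "jdt_move\<^sup>*\<^sup>* (holed N P k x) ((?r, Suc k), fil N ?P)"
    using lift_column_moves[OF h hole(2) up] unfolding hole(1) L .
  moreover have "fil N ?P (Suc ?r, Suc k) \<noteq> Some v" for v
    using below[of "v + N"] by (auto simp: fil_Suc cnt')
  \<comment> \<open>By \<open>ahead\<close>, a right neighbour in the bottom row would require more
    than \<open>?r\<close> entries in the column to its left.\<close>
  moreover have "fil N ?P (?r, Suc (Suc k)) \<noteq> Some a" for a
  proof
    assume "fil N ?P (?r, Suc (Suc k)) = Some a"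
    then have "a + N \<in> P (Suc k)" "?r = Suc (cnt (P (Suc k)) (a + N))" by (simp_all add: fil_Suc)
    then show False using ahead[of "a + N"] h top[of "Suc (a + N)"] by simp
  qed
  ultimately show ?thesis by (meson not_None_eq)
qed

end

section \<open>Slide sequences on column sets and on fillings\<close>

text \<open>The virtual entries must form an initial segment, so that they occupy exactly the top
  \<open>s\<close> boxes of the first column.\<close>

definition skew_columns :: "nat \<Rightarrow> nat \<Rightarrow> (nat \<Rightarrow> nat set) \<Rightarrow> bool" where
  "skew_columns N s P \<longleftrightarrow> interlaced P \<and> P 0 \<inter> {..<N} = {..<s} \<and> (\<forall>k. P (Suc k) \<subseteq> {N..}) \<and>
     (\<forall>k. finite (P k)) \<and> (\<exists>c. P c = {})"

lemma skew_columns_slide: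
  assumes P: "skew_columns N (Suc s) P" and c: "chain P m y" "y 0 = s"
  shows "skew_columns N s (slide P m y)"
proof -
  have i: "interlaced P" and v: "P 0 \<inter> {..<N} = {..<Suc s}" and r: "\<And>k. P (Suc k) \<subseteq> {N..}"
    and f: "\<And>k. finite (P k)" using P by (auto simp: skew_columns_def)
  have y: "N \<le> y (Suc k)" if "k < m" for k
    using chain_mem[OF c(1), of "Suc k"] r that by fastforce
  have "slide P m y 0 \<inter> {..<N} = P 0 \<inter> {..<N} - {s}"
    using y[of 0] c(2) by (auto simp: slide_def)
  moreover have "{..<Suc s} - {s} = {..<s}" by auto
  ultimately have "slide P m y 0 \<inter> {..<N} = {..<s}" unfolding v by (simp only:)
  moreover have "slide P m y (Suc k) \<subseteq> {N..}" for k
    using y[of "Suc k"] r[of k] by (auto simp: slide_def)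
  moreover have "finite (slide P m y k)" for k using f by (simp add: slide_def)
  moreover have "\<exists>c. slide P m y c = {}"
  proof -
    obtain c' where c': "P c' = {}" using P by (auto simp: skew_columns_def)
    have "m < c'"
    proof (rule ccontr)
      assume "\<not> m < c'"
      then show False using chain_mem[OF c(1), of c'] c' by simp
    qed
    then have "slide P m y c' = {}" using c' by (simp add: slide_def)
    then show ?thesis by blast
  qed
  ultimately show ?thesis using interlaced_slide[OF i c(1)] by (simp add: skew_columns_def)
qed

lemma chain_jdt_slide:
  assumes P: "skew_columns N (Suc s) P" and c: "chain P m y" "y 0 = s"
  shows "jdt_slide (Suc s, 1) (fil N P) (fil N (slide P m y))"
proof -
  have i: "interlaced P" and v: "P 0 \<inter> {..<N} = {..<Suc s}" and r: "\<And>k. P (Suc k) \<subseteq> {N..}"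
    and f: "\<And>k. finite (P k)" using P by (auto simp: skew_columns_def)
  \<comment> \<open>The tableau when the hole enters column \<open>l\<close>: the columns to its
    left have been slid, the others are untouched.\<close>
  define R where "R l i = (if i < l then slide P m y i else P i)" for l i
  have sN: "s < N" and s0: "{..<Suc s} \<subseteq> P 0" using v by auto
  have real: "N \<le> u" if "u \<in> R l l" "y l < u" "l \<le> m" for l u
  proof (cases l)
    case 0
    then have "u \<in> P 0" "s < u" using that c(2) by (auto simp: R_def)
    then show ?thesis using v by (metis Int_iff lessThan_iff not_less less_Suc_eq_le)
  next
    case (Suc k)
    then show ?thesis using r[of k] that by (auto simp: R_def)
  qed
  have Rl: "R l l = P l" "R l (Suc l) = P (Suc l)" for l by (simp_all add: R_def)
  have le: "cnt (R l (Suc l)) z \<le> cnt (R l l) z" for l z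
    using i by (simp add: Rl interlaced_def)
  have mem: "y l \<in> R l l" if "l \<le> m" for l using chain_mem[OF c(1) that] by (simp add: Rl)
  have moves: "jdt_move\<^sup>*\<^sup>* (holed N P 0 s) (holed N (R l) l (y l))" if "l \<le> m" for l
    using that
  proof (induction l)
    case 0
    have "R 0 = P" by (simp add: R_def fun_eq_iff)
    then show ?case using c(2) by simp
  next
    case (Suc l)
    then have l: "l < m" by simp
    have "crosses (R l l) (R l (Suc l)) (y l) (y (Suc l))"
      using c(1) l by (simp add: Rl chain_def)
    moreover have "N \<le> u" if "u \<in> R l (Suc l)" for u using r[of l] that by (auto simp: Rl)
    ultimately have "jdt_move\<^sup>*\<^sup>* (holed N (R l) l (y l))
        (holed N ((R l)(l := insert (y (Suc l)) (R l l - {y l}))) (Suc l) (y (Suc l)))"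
      using hole_crosses[of "R l" l "y l" N "y (Suc l)"] le mem real l by simp
    moreover have "(R l)(l := insert (y (Suc l)) (R l l - {y l})) = R (Suc l)"
      using l by (auto simp: R_def slide_def fun_eq_iff)
    moreover have "jdt_move\<^sup>*\<^sup>* (holed N P 0 s) (holed N (R l) l (y l))" using Suc by simp
    ultimately show ?case by (metis rtranclp_trans)
  qed
  have "\<not> crosses (R m m) (R m (Suc m)) (y m) z" for z using c(1) by (simp add: Rl chain_def)
  then obtain i j where ij: "jdt_move\<^sup>*\<^sup>* (holed N (R m) m (y m)) ((i, j), fil N ((R m)(m := R m m - {y m})))"
    "fil N ((R m)(m := R m m - {y m})) (Suc i, j) = None"
    "fil N ((R m)(m := R m m - {y m})) (i, Suc j) = None"
    using hole_stops[of "R m" m "y m" N] le mem real f[of m] by (auto simp: Rl)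
  moreover have "(R m)(m := R m m - {y m}) = slide P m y"
    by (auto simp: R_def slide_def fun_eq_iff)
  \<comment> \<open>The entry \<open>s\<close> is virtual and has no box in the filling, so the
    initial hole is the corner \<open>(Suc s, 1)\<close> and nothing is erased.\<close>
  moreover have "holed N P 0 s = ((Suc s, 1), fil N P)"
  proof -
    have "P 0 \<inter> {..<s} = {..<s}" using s0 by auto
    then have cs: "cnt (P 0) s = s" by (simp add: cnt_def)
    have "fil N P (Suc s, Suc 0) \<noteq> Some w" for w
    proof
      assume "fil N P (Suc s, Suc 0) = Some w"
      then have "cnt (P 0) (w + N) = s" by (simp add: fil_Suc)
      moreover have "cnt (P 0) s < cnt (P 0) (w + N)" using sN s0 by (intro cnt_less) auto
      ultimately show False using cs by simp
    qed
    then have "fil N P (Suc s, Suc 0) = None" using not_None_eq by blast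
    then show ?thesis using cs by (auto simp: holed_def)
  qed
  ultimately have "jdt_move\<^sup>*\<^sup>* ((Suc s, 1), fil N P) ((i, j), fil N (slide P m y))"
    using moves[of m] by (metis order_refl rtranclp_trans)
  then show ?thesis unfolding jdt_slide_def using ij
    \<open>(R m)(m := R m m - {y m}) = slide P m y\<close> by auto
qed

lemma young_column: "young ({1..s} \<times> {1})"
  by (auto simp: young_def)

text \<open>A column has only its bottom box as a corner, so the order of the slides is
  forced.\<close>

lemma jdt_step_column:
  "jdt_step ({1..Suc s} \<times> {1}, T) Y \<longleftrightarrow>
     (\<exists>T'. Y = ({1..s} \<times> {1}, T') \<and> jdt_slide (Suc s, 1) T T')"
proof
  assume "jdt_step ({1..Suc s} \<times> {1}, T) Y"
  then show "\<exists>T'. Y = ({1..s} \<times> {1}, T') \<and> jdt_slide (Suc s, 1) T T'"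
  proof cases
    case (1 h T')
    have "h = (Suc s, 1)"
    proof (rule ccontr)
      assume "h \<noteq> (Suc s, 1)"
      moreover obtain i where "h = (i, 1)" "1 \<le> i" "i \<le> Suc s" using 1(3) by auto
      ultimately have "(Suc s, 1) \<in> {1..Suc s} \<times> {1} - {h}" "i \<in> {1..Suc s}"
        by auto
      then have "(i, 1) \<in> {1..Suc s} \<times> {1} - {h}" using 1(4) unfolding young_def by fastforce
      then show False using \<open>h = (i, 1)\<close> by simp
    qed
    moreover have "{1..Suc s} \<times> {1} - {(Suc s, 1)} = {1..s} \<times> {1::nat}" by auto
    ultimately show ?thesis using 1 by auto
  qed
next
  assume "\<exists>T'. Y = ({1..s} \<times> {1}, T') \<and> jdt_slide (Suc s, 1) T T'"
  then obtain T' where T': "Y = ({1..s} \<times> {1}, T')" "jdt_slide (Suc s, 1) T T'" by blast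
  have eq: "{1..Suc s} \<times> {1} - {(Suc s, 1)} = {1..s} \<times> {1::nat}" by auto
  have "jdt_step ({1..Suc s} \<times> {1}, T) ({1..Suc s} \<times> {1} - {(Suc s, 1)}, T')"
    by (rule jdt_step.intros) (use T' young_column[of "Suc s"] young_column[of s] eq in auto)
  then show "jdt_step ({1..Suc s} \<times> {1}, T) Y" using T' eq by simp
qed

lemma rectifies_fil:
  assumes "rectifies s P C" "skew_columns N s P"
  shows "rectifies_to ({1..s} \<times> {1}, fil N P) (fil N C)"
  using assms
proof induction
  case (zero P)
  then show ?case by (simp add: rectifies_to_def)
next
  case (Suc P m y s C)
  have "jdt_step ({1..Suc s} \<times> {1}, fil N P) ({1..s} \<times> {1}, fil N (slide P m y))"
    using chain_jdt_slide[OF Suc.prems Suc.hyps(1,2)] jdt_step_column by blast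
  moreover have "rectifies_to ({1..s} \<times> {1}, fil N (slide P m y)) (fil N C)"
    using Suc.IH skew_columns_slide[OF Suc.prems Suc.hyps(1,2)] by blast
  ultimately show ?case unfolding rectifies_to_def by (rule converse_rtranclp_into_rtranclp)
qed

text \<open>By determinism every rectification of the filling comes from one on column sets; the
  paths exist because the columns run out.\<close>

lemma fil_rectifies:
  assumes "rectifies_to ({1..s} \<times> {1}, fil N P) R" "skew_columns N s P"
  shows "\<exists>C. rectifies s P C \<and> R = fil N C"
  using assms
proof (induction s arbitrary: P)
  case 0
  have "R = fil N P"
    using 0(1) unfolding rectifies_to_def
    by (cases rule: converse_rtranclpE) (auto elim: jdt_step.cases)
  then show ?case using rectifies.zero by blast
next
  case (Suc s)
  have "s \<in> P 0" using Suc.prems(2) by (auto simp: skew_columns_def)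
  moreover obtain c where "P c = {}" using Suc.prems(2) by (auto simp: skew_columns_def)
  ultimately obtain m y where c: "chain P m y" "y 0 = s" using chain_exists by blast
  have ne: "{1..Suc s} \<times> {1::nat} \<noteq> {}" by auto
  obtain Y where Y: "jdt_step ({1..Suc s} \<times> {1}, fil N P) Y" "jdt_step\<^sup>*\<^sup>* Y ({}, R)"
    using Suc.prems(1) ne unfolding rectifies_to_def by (metis Pair_inject converse_rtranclpE)
  then obtain T' where T': "Y = ({1..s} \<times> {1}, T')" "jdt_slide (Suc s, 1) (fil N P) T'"
    using jdt_step_column by blast
  then have "T' = fil N (slide P m y)"
    using jdt_slide_unique chain_jdt_slide[OF Suc.prems(2) c] by blast
  then have "rectifies_to ({1..s} \<times> {1}, fil N (slide P m y)) R"
    using Y(2) T'(1) unfolding rectifies_to_def by blast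
  then obtain C where "rectifies s (slide P m y) C" "R = fil N C"
    using Suc.IH skew_columns_slide[OF Suc.prems(2) c] by blast
  then show ?case using rectifies.Suc[OF c] by blast
qed

section \<open>Fillings as sequences of columns\<close>

definition entries :: "filling \<Rightarrow> nat \<Rightarrow> nat set" where
  "entries T k = {v. \<exists>i. T (i, k) = Some v}"

text \<open>Inverse to \<open>fil N\<close>, with the virtual entries put back.\<close>

definition column_sets :: "nat \<Rightarrow> nat \<Rightarrow> filling \<Rightarrow> nat \<Rightarrow> nat set" where
  "column_sets N s T k = (if k = 0 then {..<s} else {}) \<union> (\<lambda>v. v + N) ` entries T (Suc k)"

definition skew_dom :: "nat \<Rightarrow> (nat \<Rightarrow> nat) \<Rightarrow> cell set" where
  "skew_dom s l = {(i, k). \<exists>k'. k = Suc k' \<and> (if k' = 0 then s else 0) < i \<and> i \<le> l k'}"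

lemma skew_dom_Suc: "(i, Suc k) \<in> skew_dom s l \<longleftrightarrow> (if k = 0 then s else 0) < i \<and> i \<le> l k"
  by (simp add: skew_dom_def)

lemma num_cols_skew_dom:
  assumes "\<And>k. 0 < \<beta> k \<longleftrightarrow> k < c"
  shows "num_cols (skew_dom 0 \<beta>) = c"
proof -
  have "snd ` skew_dom 0 \<beta> = {1..c}"
  proof (intro equalityI subsetI)
    fix k assume "k \<in> snd ` skew_dom 0 \<beta>"
    then obtain i k' where "k = Suc k'" "(i, Suc k') \<in> skew_dom 0 \<beta>" by (auto simp: skew_dom_def)
    then show "k \<in> {1..c}" using assms[of k'] unfolding skew_dom_Suc by auto
  next
    fix k assume k: "k \<in> {1..c}"
    then have "0 < \<beta> (k - 1)" by (subst assms) auto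
    then have "(1, Suc (k - 1)) \<in> skew_dom 0 \<beta>" unfolding skew_dom_Suc by auto
    then show "k \<in> snd ` skew_dom 0 \<beta>" using k by (intro image_eqI[of _ _ "(1, k)"]) auto
  qed
  then show ?thesis by (simp add: num_cols_def)
qed

lemma semistandard_col:
  assumes "semistandard T" "T (i, k) = Some a" "T (i', k) = Some b"
  shows "a < b \<longleftrightarrow> i < i'"
proof -
  have "x < y" if "p < q" "T (p, k) = Some x" "T (q, k) = Some y" for p q x y
    using assms(1) that unfolding semistandard_def by blast
  from this[of i i' a b] this[of i' i b a] show ?thesis
    using assms(2,3) by (cases i i' rule: linorder_cases) auto
qed

lemma semistandard_row:
  assumes "semistandard T" "T (i, k) = Some a" "T (i, k') = Some b" "k < k'"
  shows "a \<le> b"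
  using assms unfolding semistandard_def by blast

lemma column_eq:
  assumes T: "semistandard T" and f: "finite {i. (i, k) \<in> dom T}"
  shows "column T k = sorted_list_of_set (entries T k)"
proof -
  let ?I = "{i. (i, k) \<in> dom T}"
  let ?f = "\<lambda>i. the (T (i, k))"
  have im: "?f ` ?I = entries T k" by (force simp: entries_def)
  have "?f x < ?f y" if "x \<in> ?I" "y \<in> ?I" "x < y" for x y
    using that semistandard_col[OF T] by auto
  then have "sorted_wrt (<) (map ?f (sorted_list_of_set ?I))"
    using f by (auto simp: sorted_wrt_map intro!: sorted_wrt_mono_rel[OF _ strict_sorted_list_of_set])
  moreover have "set (map ?f (sorted_list_of_set ?I)) = entries T k" using f im by simp
  ultimately show ?thesis unfolding column_def
    by (metis sorted_list_of_set.idem_if_sorted_distinct strict_sorted_iff)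
qed

text \<open>Compares entries of equal rank, that is, in the same row, which is the form in which
  semistandardness is given.\<close>

lemma cnt_leI:
  assumes "\<And>v. v \<in> Q \<Longrightarrow> \<exists>u\<in>P. u \<le> v \<and> cnt P u = cnt Q v"
  shows "cnt Q z \<le> cnt P z"
proof (cases "cnt Q z = 0")
  case False
  then obtain y where y: "y \<in> Q" "y < z" "Suc (cnt Q y) = cnt Q z" using cnt_pred by blast
  then obtain u where u: "u \<in> P" "u \<le> y" "cnt P u = cnt Q y" using assms by blast
  then have "cnt P (Suc u) \<le> cnt P z" using y by (intro cnt_mono) simp
  then show ?thesis using u y by (simp add: cnt_Suc)
qed simp

context
  fixes N s l T
  assumes T: "semistandard T" and D: "dom T = skew_dom s l" and s: "s \<le> N" "s \<le> l 0"
begin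

lemma column_sets_rank:
  assumes "T (i, Suc k) = Some v"
  shows "Suc (cnt (column_sets N s T k) (v + N)) = i"
proof -
  define a where "a = (if k = 0 then s else 0)"
  let ?f = "\<lambda>i. the (T (i, Suc k)) + N"
  have dom: "T (i', Suc k) \<noteq> None \<longleftrightarrow> a < i' \<and> i' \<le> l k" for i'
    using D skew_dom_Suc[of i' k s l] by (auto simp: a_def domIff)
  have i: "a < i" "i \<le> l k" using dom[of i] assms by auto
  have some: "T (i', Suc k) = Some (the (T (i', Suc k)))" if "a < i'" "i' \<le> i" for i'
    using dom[of i'] that i by auto
  have "column_sets N s T k \<inter> {..<v + N} = {..<a} \<union> ?f ` {a<..<i}"
  proof (intro equalityI subsetI)
    fix u assume u: "u \<in> column_sets N s T k \<inter> {..<v + N}"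
    show "u \<in> {..<a} \<union> ?f ` {a<..<i}"
    proof (cases "u \<in> {..<a}")
      case False
      then obtain w i' where w: "u = w + N" "T (i', Suc k) = Some w" "w < v"
        using u by (auto simp: column_sets_def entries_def a_def split: if_splits)
      then have "i' < i" using semistandard_col[OF T w(2) assms] by simp
      moreover have "a < i'" using dom[of i'] w by simp
      ultimately show ?thesis using w by (intro UnI2 image_eqI[of _ _ i']) auto
    qed simp
  next
    fix u assume u: "u \<in> {..<a} \<union> ?f ` {a<..<i}"
    then show "u \<in> column_sets N s T k \<inter> {..<v + N}"
    proof
      assume "u \<in> {..<a}"
      then show ?thesis using s(1) by (auto simp: column_sets_def a_def split: if_splits)
    next
      assume "u \<in> ?f ` {a<..<i}"
      then obtain i' where i': "u = ?f i'" "a < i'" "i' < i" by auto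
      then have "the (T (i', Suc k)) < v"
        using semistandard_col[OF T some[of i'] assms] by simp
      moreover have "the (T (i', Suc k)) \<in> entries T (Suc k)"
        using some[of i'] i' unfolding entries_def by auto
      ultimately show ?thesis using i'(1) by (simp add: column_sets_def)
    qed
  qed
  moreover have "inj_on ?f {a<..<i}"
  proof (rule inj_onI)
    fix x y assume xy: "x \<in> {a<..<i}" "y \<in> {a<..<i}" "?f x = ?f y"
    then show "x = y"
      using semistandard_col[OF T some[of x] some[of y]] semistandard_col[OF T some[of y] some[of x]]
      by (cases x y rule: linorder_cases) auto
  qed
  moreover have "{..<a} \<inter> ?f ` {a<..<i} = {}" using s(1) by (auto simp: a_def)
  ultimately have "cnt (column_sets N s T k) (v + N) = a + (i - Suc a)"
    by (simp add: cnt_def card_Un_disjoint card_image)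
  then show ?thesis using i by simp
qed

lemma fil_column_sets: "T = fil N (column_sets N s T)"
proof
  fix c :: cell
  obtain i k where c: "c = (i, k)" by force
  show "T c = fil N (column_sets N s T) c"
  proof (cases k)
    case 0
    then have "c \<notin> dom T" unfolding D c by (simp add: skew_dom_def)
    then show ?thesis using c 0 by (simp add: fil_0 domIff)
  next
    case (Suc k')
    show ?thesis unfolding c Suc
    proof (rule option_eqI)
      fix v
      have "v + N \<in> column_sets N s T k' \<longleftrightarrow> (\<exists>i. T (i, Suc k') = Some v)"
        using s(1) by (auto simp: column_sets_def entries_def)
      then show "T (i, Suc k') = Some v \<longleftrightarrow> fil N (column_sets N s T) (i, Suc k') = Some v"
        unfolding fil_Suc using column_sets_rank by metis
    qed
  qed
qed

lemma finite_entries: "finite (entries T (Suc k))"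
proof -
  have "entries T (Suc k) \<subseteq> (\<lambda>i. the (T (i, Suc k))) ` {..l k}"
  proof
    fix v assume "v \<in> entries T (Suc k)"
    then obtain i where i: "T (i, Suc k) = Some v" by (auto simp: entries_def)
    then have "(i, Suc k) \<in> skew_dom s l" unfolding D[symmetric] by blast
    then show "v \<in> (\<lambda>i. the (T (i, Suc k))) ` {..l k}"
      using i by (intro image_eqI[of _ _ i]) (auto simp: skew_dom_Suc)
  qed
  then show ?thesis by (rule finite_subset) simp
qed

lemma finite_column_sets: "finite (column_sets N s T k)"
  using finite_entries by (simp add: column_sets_def)

lemma interlaced_column_sets:
  assumes l: "\<And>k. l (Suc k) \<le> l k"
  shows "interlaced (column_sets N s T)"
  unfolding interlaced_def
proof (intro allI cnt_leI)
  fix k z v assume "v \<in> column_sets N s T (Suc k)"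
  then obtain w i where w: "v = w + N" "T (i, Suc (Suc k)) = Some w"
    by (auto simp: column_sets_def entries_def)
  then have "(i, Suc (Suc k)) \<in> skew_dom s l" unfolding D[symmetric] by blast
  then have i: "0 < i" "i \<le> l k" using l[of k] by (auto simp: skew_dom_Suc)
  have r: "cnt (column_sets N s T (Suc k)) v = i - 1"
    using column_sets_rank[OF w(2)] w(1) by simp
  show "\<exists>u\<in>column_sets N s T k. u \<le> v \<and> cnt (column_sets N s T k) u = cnt (column_sets N s T (Suc k)) v"
  proof (cases "k = 0 \<and> i \<le> s")
    \<comment> \<open>Beside a removed box of the first column the left neighbour is the virtual
      entry \<open>i - 1\<close>.\<close>
    case True
    then have "column_sets N s T k \<inter> {..<i - 1} = {..<i - 1}" by (auto simp: column_sets_def)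
    then have "cnt (column_sets N s T k) (i - 1) = i - 1" by (simp add: cnt_def)
    then show ?thesis using True i s(1) w(1) r
      by (intro bexI[of _ "i - 1"]) (auto simp: column_sets_def)
  next
    case False
    then have "(i, Suc k) \<in> dom T" unfolding D skew_dom_Suc using i by auto
    then obtain u where u: "T (i, Suc k) = Some u" by blast
    then have "u \<le> w" using semistandard_row[OF T u w(2)] by simp
    moreover have "u + N \<in> column_sets N s T k" using u by (auto simp: column_sets_def entries_def)
    moreover have "cnt (column_sets N s T k) (u + N) = i - 1" using column_sets_rank[OF u] by simp
    ultimately show ?thesis using w(1) r by (intro bexI[of _ "u + N"]) auto
  qed
qed

lemma skew_columns_column_sets:
  assumes l: "\<And>k. l (Suc k) \<le> l k" and "l c = 0"
  shows "skew_columns N s (column_sets N s T)"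
proof -
  have "entries T (Suc (Suc c)) = {}"
  proof (rule ccontr)
    assume "entries T (Suc (Suc c)) \<noteq> {}"
    then obtain i where "(i, Suc (Suc c)) \<in> dom T" by (auto simp: entries_def)
    then show False unfolding D skew_dom_Suc using l[of c] assms(2) by auto
  qed
  then have "column_sets N s T (Suc c) = {}" by (simp add: column_sets_def)
  moreover have "column_sets N s T 0 \<inter> {..<N} = {..<s}" using s(1) by (auto simp: column_sets_def)
  moreover have "\<forall>k. column_sets N s T (Suc k) \<subseteq> {N..}" by (auto simp: column_sets_def)
  ultimately show ?thesis
    unfolding skew_columns_def using interlaced_column_sets[OF l] finite_column_sets
    by (intro conjI allI exI[of _ "Suc c"]) simp_all
qed

lemma card_entries: "card (entries T (Suc k)) = l k - (if k = 0 then s else 0)"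
proof -
  let ?I = "{if k = 0 then s else 0<..l k}"
  have dom: "T (i', Suc k) \<noteq> None \<longleftrightarrow> i' \<in> ?I" for i'
    using D skew_dom_Suc[of i' k s l] by (auto simp: domIff)
  have "entries T (Suc k) = (\<lambda>i. the (T (i, Suc k))) ` ?I"
  proof (intro equalityI subsetI)
    fix v assume "v \<in> entries T (Suc k)"
    then obtain i where i: "T (i, Suc k) = Some v" by (auto simp: entries_def)
    then have "i \<in> ?I" using dom[of i] by simp
    then show "v \<in> (\<lambda>i. the (T (i, Suc k))) ` ?I" using i by (intro image_eqI[of _ _ i]) simp_all
  next
    fix v assume "v \<in> (\<lambda>i. the (T (i, Suc k))) ` ?I"
    then obtain i where i: "i \<in> ?I" "v = the (T (i, Suc k))" by blast
    then have "T (i, Suc k) = Some v" using dom[of i] by auto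
    then show "v \<in> entries T (Suc k)" by (auto simp: entries_def)
  qed
  moreover have "inj_on (\<lambda>i. the (T (i, Suc k))) ?I"
  proof (rule inj_onI)
    fix x y assume xy: "x \<in> ?I" "y \<in> ?I" "the (T (x, Suc k)) = the (T (y, Suc k))"
    then have "T (x, Suc k) = Some (the (T (x, Suc k)))" "T (y, Suc k) = Some (the (T (y, Suc k)))"
      using dom[of x] dom[of y] by auto
    from semistandard_col[OF T this] semistandard_col[OF T this(2,1)] xy(3) show "x = y"
      by (cases x y rule: linorder_cases) auto
  qed
  ultimately show ?thesis by (simp add: card_image)
qed

lemma card_column_sets: "card (column_sets N s T k) = l k"
proof -
  have "card ((\<lambda>v. v + N) ` entries T (Suc k)) = l k - (if k = 0 then s else 0)"
    using card_entries by (simp add: card_image)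
  moreover have "{..<s} \<inter> (\<lambda>v. v + N) ` entries T (Suc 0) = {}" using s(1) by auto
  ultimately show ?thesis using finite_entries s(2)
    by (cases k) (simp_all add: column_sets_def card_Un_disjoint)
qed

end

lemma rectifies_skew_columns:
  "rectifies s P C \<Longrightarrow> skew_columns N s P \<Longrightarrow> skew_columns N 0 C"
  by (induction rule: rectifies.induct) (use skew_columns_slide in blast)+

lemma entries_fil: "entries (fil N P) (Suc k) = {v. v + N \<in> P k}"
  by (auto simp: entries_def fil_Suc)

text \<open>Without virtual entries every value is at least \<open>N\<close>, so undoing the shift
  loses nothing.\<close>

lemma fil_inject:
  assumes P: "skew_columns N 0 P" and Q: "skew_columns N 0 Q" and "fil N P = fil N Q"
  shows "P = Q"
proof
  fix k
  have "{v. v + N \<in> P k} = {v. v + N \<in> Q k}" using assms(3) entries_fil by metis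
  moreover have "R k = (\<lambda>v. v + N) ` {v. v + N \<in> R k}" if "skew_columns N 0 R" for R
  proof -
    have "N \<le> u" if "u \<in> R k" for u
      using \<open>skew_columns N 0 R\<close> that by (cases k) (fastforce simp: skew_columns_def)+
    then have "u \<in> (\<lambda>v. v + N) ` {v. v + N \<in> R k}" if "u \<in> R k" for u
      using that by (intro image_eqI[of _ _ "u - N"]) simp_all
    then show ?thesis by auto
  qed
  ultimately show "P k = Q k" using P Q by metis
qed

context
  fixes N s P
  assumes P: "skew_columns N s P"
begin

lemma fil_dom: "dom (fil N P) = skew_dom s (\<lambda>k. card (P k))"
proof -
  have v: "P 0 \<inter> {..<N} = {..<s}" and r: "\<And>k. P (Suc k) \<subseteq> {N..}" and f: "\<And>k. finite (P k)"
    using P by (auto simp: skew_columns_def)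
  have iff: "(\<exists>v. fil N P (i, Suc k) = Some v) \<longleftrightarrow> (if k = 0 then s else 0) < i \<and> i \<le> card (P k)" for i k
  proof
    assume "\<exists>v. fil N P (i, Suc k) = Some v"
    then obtain v where u: "v + N \<in> P k" "i = Suc (cnt (P k) (v + N))" unfolding fil_Suc by blast
    then have "i \<le> card (P k)" using cnt_range[OF f, of k] by (auto simp: Suc_le_eq)
    moreover have "s < i" if "k = 0"
    proof -
      have "P 0 \<inter> {..<N} \<subseteq> P 0 \<inter> {..<v + N}" by auto
      then have "card (P 0 \<inter> {..<N}) \<le> cnt (P 0) (v + N)" unfolding cnt_def by (intro card_mono) auto
      then have "s \<le> cnt (P 0) (v + N)" unfolding v by simp
      then show ?thesis using u that by simp
    qed
    ultimately show "(if k = 0 then s else 0) < i \<and> i \<le> card (P k)" using u by auto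
  next
    assume i: "(if k = 0 then s else 0) < i \<and> i \<le> card (P k)"
    then have "i - 1 \<in> cnt (P k) ` P k" unfolding cnt_range[OF f] by (cases i) auto
    then obtain u where u: "u \<in> P k" "cnt (P k) u = i - 1" by auto
    have "N \<le> u"
    proof (cases k)
      case 0
      show ?thesis
      proof (rule ccontr)
        assume "\<not> N \<le> u"
        then have "u \<in> P 0 \<inter> {..<N}" using u(1) 0 by simp
        then have "u < s" unfolding v by simp
        then have "{..<u} \<subseteq> {..<s}" by auto
        also have "\<dots> \<subseteq> P 0" unfolding v[symmetric] by (rule Int_lower1)
        finally have "cnt (P 0) u = u" by (simp add: cnt_def Int_absorb1)
        then show False using u i 0 \<open>u < s\<close> by (cases i) simp_all
      qed
    next
      case (Suc l)
      then show ?thesis using r[of l] u(1) by auto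
    qed
    then have "fil N P (i, Suc k) = Some (u - N)" unfolding fil_Suc using u i by auto
    then show "\<exists>v. fil N P (i, Suc k) = Some v" by blast
  qed
  show ?thesis
  proof (rule set_eqI)
    fix c :: cell
    obtain i k where c: "c = (i, k)" by force
    show "c \<in> dom (fil N P) \<longleftrightarrow> c \<in> skew_dom s (\<lambda>k. card (P k))"
    proof (cases k)
      case 0
      then show ?thesis by (simp add: c domIff fil_0 skew_dom_def)
    next
      case (Suc k')
      then show ?thesis using iff[of i k'] unfolding c Suc skew_dom_Suc dom_def by simp
    qed
  qed
qed

lemma fil_semistandard: "semistandard (fil N P)"
proof -
  have step: "cnt (P (Suc k)) z \<le> cnt (P k) z" for k z
    using P by (simp add: skew_columns_def interlaced_def)
  have le: "cnt (P l) z \<le> cnt (P k) z" if "k \<le> l" for k l z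
    using that by (induction l rule: dec_induct) (auto intro: order_trans[OF step])
  have "a \<le> b" if h: "j < j'" "fil N P (i, j) = Some a" "fil N P (i, j') = Some b" for i j j' a b
  proof -
    obtain k k' where k: "j = Suc k" "j' = Suc k'" "k \<le> k'"
      using h by (cases j; cases j') (auto simp: fil_0)
    have a: "a + N \<in> P k" "i = Suc (cnt (P k) (a + N))"
      and b: "b + N \<in> P k'" "i = Suc (cnt (P k') (b + N))"
      using h unfolding k fil_Suc by simp_all
    then have "cnt (P k) (a + N) < cnt (P k') (Suc (b + N))" by (simp add: cnt_Suc)
    also have "\<dots> \<le> cnt (P k) (Suc (b + N))" by (rule le[OF k(3)])
    finally show ?thesis using cnt_less_iff[OF a(1), of "Suc (b + N)"] by simp
  qed
  moreover have "a < b" if h: "i < i'" "fil N P (i, j) = Some a" "fil N P (i', j) = Some b" for i i' j a b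
  proof -
    obtain k where k: "j = Suc k" using h by (cases j) (auto simp: fil_0)
    have "a + N \<in> P k" "cnt (P k) (a + N) < cnt (P k) (b + N)"
      using h unfolding k fil_Suc by simp_all
    then show ?thesis using cnt_less_iff by simp
  qed
  ultimately show ?thesis unfolding semistandard_def by blast
qed

end

lemma cnt_shift: "cnt ((\<lambda>v. v + N) ` A) z = cnt A (z - N)"
proof -
  have "(\<lambda>v. v + N) ` A \<inter> {..<z} = (\<lambda>v. v + N) ` (A \<inter> {..<z - N})" by auto
  then show ?thesis by (simp add: cnt_def card_image)
qed

lemma matching_shift:
  assumes "matching A X B"
  shows "matching ((\<lambda>v. v + N) ` A) ((\<lambda>v. v + N) ` X) ((\<lambda>v. v + N) ` B)"
  using assms by (fastforce simp: matching_def cnt_shift)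

section \<open>Left key columns from matchings\<close>

lemma skew_boxes_Suc:
  "(i, Suc k) \<in> skew_boxes as bs \<longleftrightarrow> k < length bs \<and> as ! k < i \<and> i \<le> as ! k + bs ! k"
  by (auto simp: skew_boxes_def)

text \<open>Moving a column to the front pushes the columns before it one place to the right; placed
  under the inner column, the new first column ends at the depth of the longest one. Here
  \<open>j\<close> counts from 0, hence \<open>Suc j\<close>.\<close>

lemma skew_boxes_left_key:
  assumes "j < c" and \<beta>: "\<And>k. \<beta> (Suc k) \<le> \<beta> k" "\<And>k. 0 < \<beta> k \<longleftrightarrow> k < c" and b: "\<And>k. b (Suc k) = \<beta> k"
  shows "skew_boxes ((b 1 - b (Suc j)) # replicate (c - 1) 0)
      (map b (Suc j # remove1 (Suc j) [1..<Suc c])) =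
    skew_dom (\<beta> 0 - \<beta> j)
      (\<lambda>k. if k = 0 then \<beta> 0 else if k \<le> j then \<beta> (k - 1) else \<beta> k)"
    (is "skew_boxes ?as ?bs = skew_dom ?d ?o")
proof -
  have "[1..<Suc c] = [1..<Suc j] @ [Suc j..<Suc c]"
    using upt_add_eq_append[of 1 "Suc j" "c - j"] assms(1) by (simp del: upt_Suc)
  also have "[Suc j..<Suc c] = Suc j # [Suc (Suc j)..<Suc c]"
    using assms(1) by (intro upt_conv_Cons) simp
  finally have "[1..<Suc c] = [1..<Suc j] @ Suc j # [Suc (Suc j)..<Suc c]" .
  then have r: "remove1 (Suc j) [1..<Suc c] = [1..<Suc j] @ [Suc (Suc j)..<Suc c]"
    by (simp add: remove1_append del: upt_Suc)
  have len: "length ?bs = c" unfolding r using assms(1) by (simp del: upt_Suc)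
  have "\<beta> j \<le> \<beta> 0" by (rule lift_Suc_antimono_le[of \<beta>]) (simp_all add: \<beta>)
  have bs: "?as ! k + ?bs ! k = ?o k" "?as ! k = (if k = 0 then ?d else 0)" if "k < c" for k
  proof -
    show a: "?as ! k = (if k = 0 then ?d else 0)"
      using that b[of 0] b[of j] by (simp add: nth_Cons')
    have "?bs ! k = (if k = 0 then \<beta> j else if k \<le> j then \<beta> (k - 1) else \<beta> k)"
    proof (cases k)
      case (Suc l)
      then show ?thesis unfolding r using that b[of j] b[of l] b[of k]
        by (auto simp: nth_append simp del: upt_Suc)
    qed (simp add: b)
    then show "?as ! k + ?bs ! k = ?o k" using a \<open>\<beta> j \<le> \<beta> 0\<close> by simp
  qed
  have "?o k = 0" if "\<not> k < c" for k using that assms(1) \<beta>(2)[of k] by auto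
  then have "(i, Suc k) \<in> skew_boxes ?as ?bs \<longleftrightarrow> (i, Suc k) \<in> skew_dom ?d ?o" for i k
    unfolding skew_boxes_Suc skew_dom_Suc len using bs[of k] by (cases "k < c") auto
  moreover have "(i, 0) \<notin> skew_boxes as bs" "(i, 0) \<notin> skew_dom s l" for i as bs s l
    by (auto simp: skew_boxes_def skew_dom_def)
  ultimately have "(i, k) \<in> skew_boxes ?as ?bs \<longleftrightarrow> (i, k) \<in> skew_dom ?d ?o" for i k
    by (cases k) (simp_all only:)
  then show ?thesis by (intro set_eqI) (simp only: split_paired_all)
qed

lemma inner_boxes_left_key: "inner_boxes (d # replicate m 0) = {1..d} \<times> {1}"
proof -
  have "(i, k) \<in> inner_boxes (d # replicate m 0) \<longleftrightarrow> (i, k) \<in> {1..d} \<times> {1}" for i k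
    by (cases k) (auto simp: inner_boxes_def nth_Cons' split: if_splits)
  then show ?thesis by auto
qed

lemma skew_columns_entries:
  assumes "semistandard S" "dom S = skew_dom 0 \<beta>" "\<And>k. \<beta> (Suc k) \<le> \<beta> k" "\<beta> c = 0"
  shows "skew_columns N 0 (\<lambda>k. (\<lambda>v. v + N) ` entries S (Suc k))"
    "fil N (\<lambda>k. (\<lambda>v. v + N) ` entries S (Suc k)) = S"
proof -
  have eq: "column_sets N 0 S = (\<lambda>k. (\<lambda>v. v + N) ` entries S (Suc k))"
    by (intro ext) (simp add: column_sets_def)
  show "skew_columns N 0 (\<lambda>k. (\<lambda>v. v + N) ` entries S (Suc k))"
    using skew_columns_column_sets[OF assms(1,2) _ _ assms(3,4), of N] eq by simp
  show "fil N (\<lambda>k. (\<lambda>v. v + N) ` entries S (Suc k)) = S"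
    using fil_column_sets[OF assms(1,2), of N] eq by simp
qed

section \<open>The skew tableau behind one column of the left key\<close>

text \<open>\<open>L k\<close> is the part of column \<open>k\<close> reached from column
  \<open>j\<close> by the iterated matching; by its size, \<open>L j\<close> is the whole
  column.\<close>

locale key_column =
  fixes S :: filling and \<beta> :: "nat \<Rightarrow> nat" and c j :: nat and L :: "nat \<Rightarrow> nat set"
  assumes S: "semistandard S" and dom: "dom S = skew_dom 0 \<beta>"
    and anti: "\<And>k. \<beta> (Suc k) \<le> \<beta> k" and pos: "\<And>k. 0 < \<beta> k \<longleftrightarrow> k < c" and j: "j < c"
    and L: "\<And>k. k \<le> j \<Longrightarrow> L k \<subseteq> entries S (Suc k)" "\<And>k. k \<le> j \<Longrightarrow> card (L k) = \<beta> j"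
    and M: "\<And>k. k < j \<Longrightarrow> matching (L k) (entries S (Suc k) - L k) (L (Suc k))"
begin

text \<open>Both the number of removed boxes and the shift of real entries: the smallest shift
  leaving room for the virtual ones.\<close>

definition d where "d = \<beta> 0 - \<beta> j"
definition E where "E k = (\<lambda>v. v + d) ` entries S (Suc k)"
definition A where "A k = (if k \<le> j then (\<lambda>v. v + d) ` L k else E k)"
text \<open>Column 0 loses its virtual entries; column \<open>Suc k\<close> loses the unmatched
  entries that the slides have to return to column \<open>k\<close> of \<open>S\<close>.\<close>

definition X where "X k = (case k of 0 \<Rightarrow> {..<d} | Suc k \<Rightarrow> E k - A k)"
definition outer where
  "outer k = (if k = 0 then \<beta> 0 else if k \<le> j then \<beta> (k - 1) else \<beta> k)"

lemma E: "skew_columns d 0 E" "fil d E = S" "finite (E k)" "card (E k) = \<beta> k"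
proof -
  have c: "\<beta> c = 0" using pos[of c] by simp
  show "skew_columns d 0 E" "fil d E = S"
    using skew_columns_entries[OF S dom anti c, of d] unfolding E_def[abs_def] by simp_all
  have "finite (entries S (Suc k))" "card (entries S (Suc k)) = \<beta> k"
    using finite_entries[OF S dom] card_entries[OF S dom] by simp_all
  then show "finite (E k)" "card (E k) = \<beta> k" by (simp_all add: E_def card_image)
qed

lemma beta_le: "k \<le> l \<Longrightarrow> \<beta> l \<le> \<beta> k"
  using lift_Suc_antimono_le[of \<beta>] anti by blast

lemma E_le: "cnt (E (Suc k)) z \<le> cnt (E k) z"
  using E(1) by (simp add: skew_columns_def interlaced_def)

lemma E_ge: "E k \<subseteq> {d..}"
  by (auto simp: E_def)

lemma A_sub: "A k \<subseteq> E k"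
  using L(1) by (auto simp: A_def E_def)

lemma finA: "finite (A k)"
  using A_sub E(3) by (rule finite_subset)

lemma cardA: "k \<le> j \<Longrightarrow> card (A k) = \<beta> j"
  using L(2) by (simp add: A_def card_image)

lemma A_eq: "j \<le> k \<Longrightarrow> A k = E k"
  using card_subset_eq[OF E(3) A_sub, of k] cardA[of k] E(4)[of k] by (cases "k = j") (auto simp: A_def)

lemma matching_A: "matching (A k) (X (Suc k)) (A (Suc k))"
proof (cases "k < j")
  case True
  then have "X (Suc k) = (\<lambda>v. v + d) ` (entries S (Suc k) - L k)"
    by (auto simp: X_def A_def E_def)
  then show ?thesis using matching_shift[OF M[OF True]] True by (simp add: A_def)
next
  case False
  then show ?thesis using A_eq[of k] A_eq[of "Suc k"] E_le[of k] by (simp add: matching_def X_def)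
qed

lemma A_X: "A k \<inter> X k = {}"
  using matching_A[of "k - 1"] A_sub[of 0] E_ge[of 0]
  by (cases k) (auto simp: matching_def X_def)

lemma finX: "finite (X k)"
  using E(3) by (cases k) (simp_all add: X_def)

lemma cardX: "card (X (Suc k)) = (if k < j then \<beta> k - \<beta> j else 0)"
  using card_Diff_subset[OF finA A_sub, of k] cardA[of k] A_eq[of k] E(4)[of k] by (auto simp: X_def)

lemma X_le: "cnt (X (Suc k)) z \<le> cnt (X k) z"
proof (cases k)
  case 0
  show ?thesis
  proof (cases "z \<le> d")
    case True
    have "X (Suc 0) \<inter> {..<z} = {}" using True E_ge[of 0] by (auto simp: X_def)
    then show ?thesis using 0 by (simp add: cnt_def)
  next
    case False
    then have "cnt (X 0) z = d" by (simp add: X_def cnt_lessThan)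
    moreover have "cnt (X (Suc 0)) z \<le> d" using cnt_le_card[OF finX, of "Suc 0" z] cardX[of 0]
      by (auto simp: d_def split: if_splits)
    ultimately show ?thesis using 0 by simp
  qed
next
  case (Suc l)
  \<comment> \<open>\<open>A (Suc l)\<close> and \<open>X (Suc (Suc l))\<close> make up column
    \<open>Suc l\<close> of \<open>S\<close>, and likewise one column to the left, so the inequality
    required by \<open>matching_cnt_le\<close> is the interlacing of \<open>S\<close>.\<close>
  show ?thesis unfolding Suc
  proof (rule matching_cnt_le[OF matching_A _ finX finX])
    have "cnt (E k) z = cnt (A k) z + cnt (X (Suc k)) z" for k z
      using cnt_Diff[OF A_sub, of k z] by (simp add: X_def)
    then show "cnt (A (Suc l)) z + cnt (X (Suc (Suc l))) z \<le> cnt (A l) z + cnt (X (Suc l)) z" for z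
      using E_le[of l z] by metis
    show "card (X (Suc (Suc l))) \<le> card (X (Suc l))"
      using anti[of l] by (auto simp: cardX)
  qed
qed

lemma card_AX: "card (A k \<union> X k) = outer k"
proof -
  have "card (A k \<union> X k) = card (A k) + card (X k)" by (rule card_Un_disjoint[OF finA finX A_X])
  moreover have "card (A k) = (if k \<le> j then \<beta> j else \<beta> k)" using cardA A_eq E(4) by auto
  moreover have "card (X k) = (if k = 0 then d else if k \<le> j then \<beta> (k - 1) - \<beta> j else 0)"
    using cardX[of "k - 1"] by (cases k) (auto simp: X_def)
  ultimately show ?thesis using beta_le[of 0 j] beta_le[of "k - 1" j] by (auto simp: outer_def d_def)
qed

lemma skew_columns_AX: "skew_columns d d (\<lambda>k. A k \<union> X k)"
proof -
  have "interlaced (\<lambda>k. A k \<union> X k)"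
    using matching_A X_le unfolding interlaced_def cnt_Un[OF A_X] matching_def by (simp add: add_mono)
  moreover have "(A 0 \<union> X 0) \<inter> {..<d} = {..<d}" by (auto simp: X_def)
  moreover have "A (Suc k) \<union> X (Suc k) \<subseteq> {d..}" for k
    using A_sub[of "Suc k"] E_ge[of k] E_ge[of "Suc k"] by (auto simp: X_def)
  moreover have "A (Suc c) \<union> X (Suc c) = {}"
    using A_sub[of "Suc c"] pos[of c] pos[of "Suc c"] E(4)[of c] E(4)[of "Suc c"] E(3)[of c] E(3)[of "Suc c"]
    by (simp add: X_def)
  ultimately show ?thesis unfolding skew_columns_def using finA finX by blast
qed

lemma rectifies_AX: "rectifies d (\<lambda>k. A k \<union> X k) E"
proof -
  have "X (Suc j) = {}" using A_eq[of j] by (simp add: X_def)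
  then have "rectifies d (\<lambda>k. A k \<union> X k) (\<lambda>k. A k \<union> X (Suc k))"
    by (intro matching_rectifies[where c = "Suc j"] matching_A A_X X_le finX) (simp_all add: X_def)
  moreover have "(\<lambda>k. A k \<union> X (Suc k)) = E"
    using A_sub by (intro ext) (simp add: X_def Un_absorb1)
  ultimately show ?thesis by simp
qed

lemma key_filling:
  shows "dom (fil d (\<lambda>k. A k \<union> X k)) = skew_dom d outer" "semistandard (fil d (\<lambda>k. A k \<union> X k))"
    "rectifies_to ({1..d} \<times> {1}, fil d (\<lambda>k. A k \<union> X k)) S"
    "entries (fil d (\<lambda>k. A k \<union> X k)) 1 = L 0"
proof -
  show "dom (fil d (\<lambda>k. A k \<union> X k)) = skew_dom d outer"
    using fil_dom[OF skew_columns_AX] card_AX by simp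
  show "semistandard (fil d (\<lambda>k. A k \<union> X k))"
    by (rule fil_semistandard[OF skew_columns_AX])
  show "rectifies_to ({1..d} \<times> {1}, fil d (\<lambda>k. A k \<union> X k)) S"
    using rectifies_fil[OF rectifies_AX skew_columns_AX] E(2) by simp
  show "entries (fil d (\<lambda>k. A k \<union> X k)) 1 = L 0"
    using entries_fil[of d "\<lambda>k. A k \<union> X k" 0] by (auto simp: A_def X_def)
qed

text \<open>The matching read off from the slides of \<open>T\<close> has prescribed sizes, which
  force its last set to be all of column \<open>j\<close>. From there \<open>matching_unique\<close>
  identifies the sets one column at a time, going left.\<close>

lemma key_filling_unique:
  assumes T: "dom T = skew_dom d outer" "semistandard T" "rectifies_to ({1..d} \<times> {1}, T) S"
  shows "entries T 1 = L 0"
proof -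
  define P where "P = column_sets d d T"
  have d: "d \<le> outer 0" by (simp add: d_def outer_def)
  have anti_outer: "outer (Suc k) \<le> outer k" for k
    using anti[of k] anti[of "k - 1"] beta_le[of j "Suc k"] beta_le[of "k - 1" "Suc k"] by (auto simp: outer_def)
  have "outer (Suc c) = 0" using pos[of "Suc c"] j by (auto simp: outer_def)
  then have P: "skew_columns d d P"
    using skew_columns_column_sets[OF T(2,1) order_refl d anti_outer] by (simp add: P_def)
  have finP: "finite (P k)" for k using P by (simp add: skew_columns_def)
  have cardP: "card (P k) = outer k" for k
    using card_column_sets[OF T(2,1) order_refl d] by (simp add: P_def)
  have "T = fil d P" unfolding P_def by (rule fil_column_sets[OF T(2,1) order_refl d])
  then obtain C where C: "rectifies d P C" "S = fil d C"
    using fil_rectifies[OF _ P] T(3) by metis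
  then have "C = E"
    using fil_inject[OF rectifies_skew_columns[OF C(1) P] E(1)] E(2) by simp
  have PP: "interlaced P" "P 0 \<inter> {..<d} = {..<d}" using P by (simp_all add: skew_columns_def)
  have "{..<d} \<subseteq> P 0" by (rule order_trans[OF equalityD2[OF PP(2)] Int_lower1])
  then obtain Y where Y: "Y 0 = {..<d}" "\<And>k. Y k \<subseteq> P k"
      "\<And>k. matching (P k - Y k) (Y (Suc k)) (P (Suc k) - Y (Suc k))"
      "\<And>k. E k = (P k - Y k) \<union> Y (Suc k)"
    using rectifies_matching[OF C(1) PP(1)] unfolding \<open>C = E\<close> by metis
  have finY: "finite (Y k)" for k using Y(2) finP by (rule finite_subset)
  have cardE: "\<beta> k = card (P k - Y k) + card (Y (Suc k))" for k
    using card_Un_disjoint[of "P k - Y k" "Y (Suc k)"] Y(3)[of k] Y(4)[of k] E(4)[of k] finP finY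
    by (simp add: matching_def)
  have cardPY: "card (P k - Y k) = outer k - card (Y k)" for k
    using card_Diff_subset[OF finY Y(2)] cardP by simp
  \<comment> \<open>Sizes are determined from column 0 onwards: the departures from column
    \<open>Suc k\<close> are what column \<open>k\<close> of \<open>S\<close> still lacks.\<close>
  have card: "card (P k - Y k) = \<beta> j" if "k \<le> j" for k
    using that
  proof (induction k)
    case 0
    then show ?case using cardPY[of 0] Y(1) beta_le[of 0 j] by (simp add: outer_def d_def)
  next
    case (Suc k)
    then show ?case using cardPY[of "Suc k"] cardE[of k] beta_le[of k j] by (simp add: outer_def)
  qed
  have "P k - Y k = A k" if "k \<le> j" for k
    using that
  proof (induction k rule: inc_induct)
    case base
    have "P j - Y j \<subseteq> E j" using Y(4) by blast
    then have "P j - Y j = E j" using card_subset_eq[OF E(3)] E(4) card[of j] by simp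
    then show ?case using A_eq by simp
  next
    case (step k)
    show ?case
    proof (rule matching_unique)
      show "matching (P k - Y k) (Y (Suc k)) (A (Suc k))" using Y(3)[of k] step by simp
      show "matching (A k) (X (Suc k)) (A (Suc k))" by (rule matching_A)
      show "P k - Y k \<union> Y (Suc k) = A k \<union> X (Suc k)" using Y(4)[of k] A_sub[of k] by (auto simp: X_def)
      show "card (P k - Y k) = card (A k)" using card cardA step by simp
    qed (use finP finY finA finX in auto)
  qed
  from this[of 0] have "P 0 - {..<d} = (\<lambda>v. v + d) ` L 0" using Y(1) by (simp add: A_def)
  moreover have "P 0 - {..<d} = (\<lambda>v. v + d) ` entries T 1"
    by (auto simp: P_def column_sets_def)
  ultimately show ?thesis by (simp add: inj_image_eq_iff inj_def)
qed

lemma left_key_column_eq: "left_key_column S (Suc j) = sorted_list_of_set (L 0)"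
proof -
  have b: "col_len (dom S) (Suc k) = \<beta> k" for k
  proof -
    have "{i. (i, Suc k) \<in> dom S} = {1..\<beta> k}" unfolding dom by (auto simp: skew_dom_Suc)
    then show ?thesis by (simp add: col_len_def)
  qed
  have c: "num_cols (dom S) = c" unfolding dom by (rule num_cols_skew_dom[OF pos])
  have boxes: "skew_boxes ((col_len (dom S) 1 - col_len (dom S) (Suc j)) # replicate (c - 1) 0)
      (map (col_len (dom S)) (Suc j # remove1 (Suc j) [1..<Suc c])) = skew_dom d outer"
    unfolding outer_def[abs_def] d_def by (rule skew_boxes_left_key[OF j anti pos b])
  have d: "col_len (dom S) 1 - col_len (dom S) (Suc j) = d" using b[of 0] b[of j] by (simp add: d_def)
  have col: "column T 1 = sorted_list_of_set (entries T 1)"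
    if "semistandard T" "dom T = skew_dom d outer" for T
  proof (rule column_eq[OF that(1)])
    have "{i. (i, 1) \<in> dom T} \<subseteq> {..outer 0}" unfolding that(2) One_nat_def skew_dom_Suc by auto
    then show "finite {i. (i, 1) \<in> dom T}" by (rule finite_subset) simp
  qed
  have "left_key_column S (Suc j) = (THE C. \<exists>T. dom T = skew_dom d outer \<and> semistandard T \<and>
      rectifies_to ({1..d} \<times> {1}, T) S \<and> C = column T 1)"
    unfolding left_key_column_def Let_def c boxes rectification_equiv_straight
    unfolding d inner_boxes_left_key ..
  also have "\<dots> = sorted_list_of_set (L 0)"
  proof (rule the_equality)
    show "\<exists>T. dom T = skew_dom d outer \<and> semistandard T \<and>
      rectifies_to ({1..d} \<times> {1}, T) S \<and> sorted_list_of_set (L 0) = column T 1"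
      using key_filling col by (intro exI[of _ "fil d (\<lambda>k. A k \<union> X k)"]) simp
    fix C assume "\<exists>T. dom T = skew_dom d outer \<and> semistandard T \<and>
      rectifies_to ({1..d} \<times> {1}, T) S \<and> C = column T 1"
    then show "C = sorted_list_of_set (L 0)" using key_filling_unique col by auto
  qed
  finally show ?thesis .
qed

end

section \<open>Maximal lines\<close>

lemma dom_of_columns:
  "(i, k) \<in> dom (of_columns Ds) \<longleftrightarrow> k \<in> {1..length Ds} \<and> i \<in> {1..length (Ds ! (k - 1))}"
  by (auto simp: of_columns_def split: if_splits)

lemma column_of_columns:
  assumes "k < length Ds"
  shows "column (of_columns Ds) (Suc k) = Ds ! k"
proof -
  have "{i. (i, Suc k) \<in> dom (of_columns Ds)} = {1..length (Ds ! k)}"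
    using assms unfolding dom_of_columns by auto
  moreover have "sorted_list_of_set {1..length (Ds ! k)} = [1..<Suc (length (Ds ! k))]"
    by (simp flip: atLeastLessThanSuc_atLeastAtMost del: upt_Suc)
  ultimately have "column (of_columns Ds) (Suc k) =
      map (\<lambda>i. the (of_columns Ds (i, Suc k))) [1..<Suc (length (Ds ! k))]"
    unfolding column_def by (simp only:)
  also have "\<dots> = Ds ! k"
    by (rule nth_equalityI) (use assms in \<open>auto simp: of_columns_def simp del: upt_Suc\<close>)
  finally show ?thesis .
qed

text \<open>Deleting a line can empty columns; as the empty ones are at the right end,
  \<open>columns\<close> merely cuts them off.\<close>

lemma columns_of_columns:
  assumes "\<And>k. Suc k < length Ds \<Longrightarrow> Ds ! Suc k \<noteq> [] \<Longrightarrow> Ds ! k \<noteq> []"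
  shows "columns (of_columns Ds) = takeWhile (\<lambda>C. C \<noteq> []) Ds"
proof -
  let ?W = "takeWhile (\<lambda>C. C \<noteq> []) Ds"
  have W: "k < length ?W" if "k < length Ds" "Ds ! k \<noteq> []" for k
  proof (rule ccontr)
    assume "\<not> k < length ?W"
    then have "length ?W \<le> k" by simp
    then have "Ds ! length ?W \<noteq> []" using that
      by (induction rule: inc_induct) (use assms in auto)
    moreover have "length ?W < length Ds" using \<open>length ?W \<le> k\<close> that by simp
    ultimately show False using nth_length_takeWhile[of "\<lambda>C. C \<noteq> []" Ds] by blast
  qed
  have ne: "Ds ! k \<noteq> []" "k < length Ds" "?W ! k = Ds ! k" if "k < length ?W" for k
    using that nth_mem[OF that] set_takeWhileD takeWhile_nth[OF that] length_takeWhile_le[of _ Ds]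
    by (fastforce intro: less_le_trans)+
  have "snd ` dom (of_columns Ds) = {1..length ?W}"
  proof (intro equalityI subsetI)
    fix k assume "k \<in> snd ` dom (of_columns Ds)"
    then obtain i where "(i, k) \<in> dom (of_columns Ds)" by force
    then have "1 \<le> k" "k - 1 < length Ds" "Ds ! (k - 1) \<noteq> []" unfolding dom_of_columns by auto
    then show "k \<in> {1..length ?W}" using W[of "k - 1"] by auto
  next
    fix k assume "k \<in> {1..length ?W}"
    then have "k - 1 < length ?W" "1 \<le> k" by auto
    then have "(1, k) \<in> dom (of_columns Ds)" unfolding dom_of_columns using ne[of "k - 1"]
      by (auto simp: Suc_le_eq)
    then show "k \<in> snd ` dom (of_columns Ds)" by (intro image_eqI[of _ _ "(1, k)"]) auto
  qed
  then have n: "num_cols (dom (of_columns Ds)) = length ?W" by (simp add: num_cols_def)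
  show ?thesis
  proof (rule nth_equalityI)
    show len: "length (columns (of_columns Ds)) = length ?W" by (simp add: columns_def n del: upt_Suc)
    fix k assume "k < length (columns (of_columns Ds))"
    then have "k < length ?W" using len by simp
    then show "columns (of_columns Ds) ! k = ?W ! k"
      using column_of_columns ne by (simp add: columns_def n del: upt_Suc)
  qed
qed

lemma length_maximal_line [simp]: "length (maximal_line Cs) = length Cs"
  by (induction Cs rule: maximal_line.induct) (simp_all add: Let_def)

lemma maximal_line_last: "Cs \<noteq> [] \<Longrightarrow> maximal_line Cs ! (length Cs - 1) = Max (set (last Cs))"
  by (induction Cs rule: maximal_line.induct) (simp_all add: Let_def)

lemma maximal_line_nth:
  "Suc k < length Cs \<Longrightarrow>
    maximal_line Cs ! k = Max {x \<in> set (Cs ! k). x \<le> maximal_line Cs ! Suc k}"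
proof (induction Cs arbitrary: k rule: maximal_line.induct)
  case (3 C D Cs)
  have "hd (maximal_line (D # Cs)) = maximal_line (D # Cs) ! 0"
    using length_maximal_line[of "D # Cs"] by (intro hd_conv_nth) (metis length_0_conv list.distinct(1))
  then show ?case using 3 by (cases k) (simp_all add: Let_def)
qed simp_all

section \<open>One maximal line and its deletion\<close>

definition represents :: "nat list list \<Rightarrow> (nat \<Rightarrow> nat set) \<Rightarrow> bool" where
  "represents Cs F \<longleftrightarrow> interlaced F \<and> (\<forall>k. finite (F k)) \<and> (\<forall>k. F k \<noteq> {} \<longleftrightarrow> k < length Cs) \<and>
     (\<forall>k<length Cs. Cs ! k = sorted_list_of_set (F k))"

context
  fixes Cs F
  assumes R: "represents Cs F"
begin

lemma representsD:
  shows "cnt (F (Suc k)) z \<le> cnt (F k) z" "finite (F k)" "F k \<noteq> {} \<longleftrightarrow> k < length Cs"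
    "k < length Cs \<Longrightarrow> Cs ! k = sorted_list_of_set (F k)"
  using R unfolding represents_def interlaced_def by blast+

lemma maximal_line_end: "Suc k = length Cs \<Longrightarrow> maximal_line Cs ! k = Max (F k)"
proof -
  assume k: "Suc k = length Cs"
  then have "Cs \<noteq> []" by auto
  then have "last Cs = Cs ! k" using k by (simp add: last_conv_nth flip: k)
  moreover have "Cs ! k = sorted_list_of_set (F k)" using k by (intro representsD(4)) simp
  ultimately have "set (last Cs) = F k" using representsD(2)[of k] by simp
  then show ?thesis using maximal_line_last[OF \<open>Cs \<noteq> []\<close>] by (simp flip: k)
qed

lemma maximal_line_mem:
  assumes "k < length Cs"
  shows "maximal_line Cs ! k \<in> F k"
proof -
  have "k \<le> length Cs - 1" using assms by simp
  then show ?thesis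
  proof (induction k rule: inc_induct)
    case base
    have "Suc (length Cs - 1) = length Cs" using assms by simp
    moreover have "F (length Cs - 1) \<noteq> {}" using assms representsD(3)[of "length Cs - 1"] by simp
    ultimately show ?case using maximal_line_end Max_in[OF representsD(2)] by simp
  next
    case (step k)
    let ?w = "maximal_line Cs ! Suc k"
    let ?M = "{x \<in> F k. x \<le> ?w}"
    have k: "Suc k < length Cs" using step by simp
    \<comment> \<open>Interlacing just above \<open>?w\<close> provides an entry of column
      \<open>k\<close> that is at most \<open>?w\<close>, so the maximum is over a nonempty
      set.\<close>
    have "0 < cnt (F (Suc k)) (Suc ?w)" using step.IH by (simp add: cnt_Suc)
    then have "0 < cnt (F k) (Suc ?w)" using representsD(1)[of k "Suc ?w"] by simp
    then obtain x where "x \<in> F k" "x < Suc ?w" using cnt_pred by blast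
    then have "?M \<noteq> {}" by auto
    moreover have "maximal_line Cs ! k = Max ?M"
      using maximal_line_nth[OF k] representsD(2)[of k] representsD(4)[of k] k by simp
    ultimately have "maximal_line Cs ! k \<in> ?M" using Max_in[of ?M] representsD(2)[of k] by simp
    then show ?case by simp
  qed
qed

lemma maximal_line_step:
  assumes "Suc k < length Cs"
  shows "maximal_line Cs ! k \<le> maximal_line Cs ! Suc k"
    "x \<in> F k \<Longrightarrow> x \<le> maximal_line Cs ! Suc k \<Longrightarrow> x \<le> maximal_line Cs ! k"
proof -
  let ?w = "maximal_line Cs ! Suc k"
  let ?M = "{x \<in> F k. x \<le> ?w}"
  have v: "maximal_line Cs ! k = Max ?M" and fin: "finite ?M"
    using maximal_line_nth[OF assms] representsD(2)[of k] representsD(4)[of k] assms by simp_all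
  have "0 < cnt (F (Suc k)) (Suc ?w)" using maximal_line_mem[OF assms] by (simp add: cnt_Suc)
  then have "0 < cnt (F k) (Suc ?w)" using representsD(1)[of k "Suc ?w"] by simp
  then obtain x where "x \<in> F k" "x < Suc ?w" using cnt_pred by blast
  then have "?M \<noteq> {}" by auto
  then show "maximal_line Cs ! k \<le> ?w" using Max_in[OF fin] v by simp
  show "x \<in> F k \<Longrightarrow> x \<le> ?w \<Longrightarrow> x \<le> maximal_line Cs ! k" for x using Max_ge[OF fin, of x] v by simp
qed

lemma represents_remove:
  defines "Ds \<equiv> map2 remove1 (maximal_line Cs) Cs"
  shows "represents (columns (of_columns Ds)) (\<lambda>k. F k - {maximal_line Cs ! k})"
proof -
  let ?v = "\<lambda>k. maximal_line Cs ! k"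
  let ?F = "\<lambda>k. F k - {?v k}"
  have cnt: "cnt (F k) z = cnt (?F k) z + (if ?v k < z then 1 else 0)" if "k < length Cs" for k z
    by (rule cnt_remove[OF maximal_line_mem[OF that]])
  have le: "cnt (?F (Suc k)) z \<le> cnt (?F k) z" for k z
  proof (cases "Suc k < length Cs")
    case False
    then have "F (Suc k) = {}" using representsD(3) by blast
    then show ?thesis by simp
  next
    case True
    \<comment> \<open>The critical levels are those where only the left column has lost an entry. By
      maximality of the line, column \<open>k\<close> has no entry from \<open>z\<close> up to
      \<open>?v (Suc k)\<close>, while column \<open>Suc k\<close> has one.\<close>
    have "cnt (F (Suc k)) z < cnt (F k) z" if z: "?v k < z" "z \<le> ?v (Suc k)"
    proof -
      have "F k \<inter> {..<Suc (?v (Suc k))} = F k \<inter> {..<z}"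
        using maximal_line_step(2)[OF True] z by (auto simp: less_Suc_eq_le) (meson le_less_trans)
      then have "cnt (F k) (Suc (?v (Suc k))) = cnt (F k) z" by (simp add: cnt_def)
      moreover have "cnt (F (Suc k)) z \<le> cnt (F (Suc k)) (?v (Suc k))" using z(2) by (rule cnt_mono)
      moreover have "cnt (F (Suc k)) (?v (Suc k)) < cnt (F (Suc k)) (Suc (?v (Suc k)))"
        using maximal_line_mem[OF True] by (simp add: cnt_Suc)
      ultimately show ?thesis using representsD(1)[of k "Suc (?v (Suc k))"] by simp
    qed
    then show ?thesis
      using True cnt[of k z] cnt[of "Suc k" z] representsD(1)[of k z] maximal_line_step(1)[OF True]
      by (auto split: if_splits)
  qed
  have fin: "finite (?F k)" for k using representsD(2) by simp
  have Ds: "length Ds = length Cs" "k < length Cs \<Longrightarrow> Ds ! k = sorted_list_of_set (?F k)" for k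
    using representsD(2,4)[of k] by (simp_all add: Ds_def sorted_list_of_set_remove)
  have ne: "Ds ! k \<noteq> [] \<longleftrightarrow> ?F k \<noteq> {}" if "k < length Cs" for k
    using Ds(2)[OF that] fin[of k] by simp
  have empty: "?F k = {}" if "?F l = {}" "l \<le> k" for k l
    using that(2,1)
  proof (induction k rule: dec_induct)
    case (step k)
    have "?F k = {}" by (rule step.IH) (rule step.prems)
    then have "cnt (?F (Suc k)) z = 0" for z using le[of k z] by (simp only: cnt_empty le_zero_eq)
    then show ?case by (intro cnt_eqI) simp
  qed simp
  let ?W = "takeWhile (\<lambda>C. C \<noteq> []) Ds"
  have W: "columns (of_columns Ds) = ?W"
    by (rule columns_of_columns) (use ne empty[OF _ lessI[THEN less_imp_le]] Ds(1) in auto)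
  have len: "length ?W \<le> length Cs" using length_takeWhile_le[of _ Ds] Ds(1) by simp
  have nth: "?W ! k = Ds ! k" "Ds ! k \<noteq> []" if "k < length ?W" for k
    using takeWhile_nth[OF that] nth_mem[OF that] set_takeWhileD by (fastforce)+
  have "?F k \<noteq> {} \<longleftrightarrow> k < length ?W" for k
  proof
    assume "k < length ?W"
    then show "?F k \<noteq> {}" using nth(2) ne len less_le_trans by blast
  next
    assume F: "?F k \<noteq> {}"
    show "k < length ?W"
    proof (rule ccontr)
      assume k: "\<not> k < length ?W"
      have "k < length Cs" using F representsD(3)[of k] by blast
      then have "Ds ! length ?W = []" using k Ds(1) nth_length_takeWhile[of "\<lambda>C. C \<noteq> []" Ds] by simp
      then have "?F (length ?W) = {}" using ne[of "length ?W"] k \<open>k < length Cs\<close> by simp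
      then show False using empty[of "length ?W" k] k F by simp
    qed
  qed
  then show ?thesis unfolding represents_def W interlaced_def
    using le fin nth(1) Ds(2) len by (auto dest: less_le_trans)
qed

end

lemma cnt_image: "inj_on f I \<Longrightarrow> cnt (f ` I) z = card {t \<in> I. f t < z}"
proof -
  assume f: "inj_on f I"
  have "f ` I \<inter> {..<z} = f ` {t \<in> I. f t < z}" by auto
  then show ?thesis unfolding cnt_def using f by (simp add: card_image inj_on_subset)
qed

section \<open>The family of all maximal lines\<close>

locale lines =
  fixes S :: filling and \<beta> :: "nat \<Rightarrow> nat" and c :: nat
  assumes S: "semistandard S" and dom: "dom S = skew_dom 0 \<beta>"
    and anti: "\<And>k. \<beta> (Suc k) \<le> \<beta> k" and pos: "\<And>k. 0 < \<beta> k \<longleftrightarrow> k < c"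
begin

definition Cs where "Cs t = columns ((delete_line ^^ t) S)"
text \<open>Lines are numbered from 0. For \<open>t \<ge> \<beta> k\<close> line \<open>t\<close>
  does not reach column \<open>k\<close> and \<open>V t k\<close> is unspecified, which is harmless
  as column \<open>k\<close> is empty by then.\<close>

definition V where "V t k = maximal_line (Cs t) ! k"
definition F where "F t k = entries S (Suc k) - (\<lambda>t. V t k) ` {..<t}"

lemma beta_le: "k \<le> l \<Longrightarrow> \<beta> l \<le> \<beta> k"
  using lift_Suc_antimono_le[of \<beta>] anti by blast

lemma num_cols: "num_cols (dom S) = c"
  unfolding dom by (rule num_cols_skew_dom[OF pos])

lemma finE: "finite (entries S (Suc k))" and cardE: "card (entries S (Suc k)) = \<beta> k"
  using finite_entries[OF S dom] card_entries[OF S dom] by simp_all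

lemma represents_lines: "represents (Cs t) (F t)"
proof (induction t)
  case 0
  have "interlaced (\<lambda>k. entries S (Suc k))"
    using skew_columns_entries(1)[OF S dom anti, of c 0] pos[of c] by (simp add: skew_columns_def)
  moreover have "entries S (Suc k) \<noteq> {} \<longleftrightarrow> k < c" for k
    using cardE[of k] finE[of k] pos[of k] by (auto simp flip: card_gt_0_iff)
  moreover have "columns S ! k = sorted_list_of_set (entries S (Suc k))" if "k < c" for k
  proof -
    have "{i. (i, Suc k) \<in> dom S} \<subseteq> {..\<beta> k}" unfolding dom skew_dom_Suc by auto
    then have "finite {i. (i, Suc k) \<in> dom S}" by (rule finite_subset) simp
    then have "column S (Suc k) = sorted_list_of_set (entries S (Suc k))" by (rule column_eq[OF S])
    then show ?thesis using that by (simp add: columns_def num_cols del: upt_Suc)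
  qed
  moreover have "length (columns S) = c" by (simp add: columns_def num_cols del: upt_Suc)
  ultimately show ?case using finE by (simp add: represents_def Cs_def F_def)
next
  case (Suc t)
  have "(\<lambda>k. F t k - {maximal_line (Cs t) ! k}) = F (Suc t)"
    by (auto simp: F_def V_def fun_eq_iff lessThan_Suc)
  then show ?case using represents_remove[OF Suc] by (simp add: Cs_def delete_line_def)
qed

lemma V_mem': "k < length (Cs t) \<Longrightarrow> V t k \<in> F t k"
  unfolding V_def by (rule maximal_line_mem[OF represents_lines])

lemma F_Suc: "F (Suc t) k = F t k - {V t k}"
  by (auto simp: F_def lessThan_Suc)

lemma finF: "finite (F t k)"
  using finE by (simp add: F_def)

lemma F_nonempty: "F t k \<noteq> {} \<longleftrightarrow> k < length (Cs t)"
  using representsD(3)[OF represents_lines] .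

lemma cardF: "card (F t k) = \<beta> k - t"
proof (induction t)
  case 0
  then show ?case by (simp add: F_def cardE)
next
  case (Suc t)
  then show ?case
    using V_mem'[of k t] F_nonempty[of t k] finF[of t k] by (cases "F t k = {}") (simp_all add: F_Suc)
qed

lemma length_Cs: "k < length (Cs t) \<longleftrightarrow> t < \<beta> k"
  using F_nonempty[of t k] cardF[of t k] card_gt_0_iff[of "F t k"] finF[of t k] by simp

lemma V_mem: "t < \<beta> k \<Longrightarrow> V t k \<in> F t k"
  using V_mem' length_Cs by simp

lemma V_entries: "t < \<beta> k \<Longrightarrow> V t k \<in> entries S (Suc k)"
  using V_mem by (simp add: F_def)

lemma V_step:
  assumes "t < \<beta> (Suc k)"
  shows "V t k \<le> V t (Suc k)" "x \<in> F t k \<Longrightarrow> x \<le> V t (Suc k) \<Longrightarrow> x \<le> V t k"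
  using maximal_line_step[OF represents_lines, of k t] assms
  unfolding V_def length_Cs by blast+

lemma V_end: "t < \<beta> k \<Longrightarrow> \<not> t < \<beta> (Suc k) \<Longrightarrow> V t k = Max (F t k)"
  using maximal_line_end[OF represents_lines, of k t] length_Cs[of k t] length_Cs[of "Suc k" t]
  unfolding V_def by linarith

lemma V_inj: "m \<le> \<beta> k \<Longrightarrow> inj_on (\<lambda>t. V t k) {..<m}"
proof (rule linorder_inj_onI')
  fix t t' assume "m \<le> \<beta> k" "t \<in> {..<m}" "t' \<in> {..<m}" "t < t'"
  then have "V t' k \<notin> (\<lambda>t. V t k) ` {..<t'}" "V t k \<in> (\<lambda>t. V t k) ` {..<t'}"
    using V_mem[of t' k] by (simp_all add: F_def)
  then show "V t k \<noteq> V t' k" by metis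
qed

text \<open>Lines \<open>t\<close> and \<open>Suc t\<close> end in the same column, where line
  \<open>t\<close> takes the maximum. Going left, the entry of line \<open>Suc t\<close> was
  available to line \<open>t\<close> and within its bound, so line \<open>t\<close> chose a larger
  one.\<close>

lemma V_decreasing:
  assumes same: "\<And>k. t < \<beta> k \<longleftrightarrow> Suc t < \<beta> k" and "t < \<beta> k"
  shows "V (Suc t) k < V t k"
proof -
  have top: "V (Suc t) k < V t k" if "t < \<beta> k" "\<And>x. x \<in> F t k \<Longrightarrow> x \<le> V (Suc t) k \<Longrightarrow> x \<le> V t k" for k
  proof -
    have "V (Suc t) k \<in> F t k - {V t k}" using V_mem[of "Suc t" k] that(1) same by (simp add: F_Suc)
    then show ?thesis using that(2)[of "V (Suc t) k"] by auto
  qed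
  have k: "k \<le> length (Cs t) - 1" using assms(2) length_Cs[of k t] by simp
  then show ?thesis
  proof (induction k rule: inc_induct)
    case base
    have "0 < length (Cs t)"
      using assms(2) unfolding length_Cs[symmetric] by (rule le_less_trans[OF le0])
    then have t: "t < \<beta> (length (Cs t) - 1)" "\<not> t < \<beta> (Suc (length (Cs t) - 1))"
      using length_Cs[of "length (Cs t) - 1" t] length_Cs[of "Suc (length (Cs t) - 1)" t] by simp_all
    show ?case by (rule top[OF t(1)]) (use V_end[OF t] finF in simp)
  next
    case (step k)
    then have "Suc k < length (Cs t)" by linarith
    then have t: "t < \<beta> (Suc k)" unfolding length_Cs .
    then have "t < \<beta> k" using anti[of k] by simp
    then show ?case
    proof (rule top)
      fix x assume "x \<in> F t k" "x \<le> V (Suc t) k"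
      moreover have "V (Suc t) k \<le> V (Suc t) (Suc k)" using V_step(1) same t by blast
      ultimately show "x \<le> V t k" using step.IH V_step(2)[OF t, of x] by simp
    qed
  qed
qed

lemma matching_lines:
  assumes "m \<le> \<beta> (Suc k)"
  shows "matching ((\<lambda>t. V t k) ` {..<m}) (entries S (Suc k) - (\<lambda>t. V t k) ` {..<m})
    ((\<lambda>t. V t (Suc k)) ` {..<m})"
proof -
  let ?A = "(\<lambda>t. V t k) ` {..<m}" and ?B = "(\<lambda>t. V t (Suc k)) ` {..<m}"
  let ?X = "entries S (Suc k) - ?A"
  have le: "V t k \<le> V t (Suc k)" if "t < m" for t using V_step(1) that assms by simp
  have ge: "y \<le> V t k" if "t < m" "y \<in> ?X" "y \<le> V t (Suc k)" for t y
  proof (rule V_step(2))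
    show "y \<in> F t k" using that by (auto simp: F_def)
  qed (use that assms in auto)
  have cntA: "cnt ?A z = card {t \<in> {..<m}. V t k < z}" for z
    using assms anti[of k] by (intro cnt_image V_inj) simp
  have cntB: "cnt ?B z = card {t \<in> {..<m}. V t (Suc k) < z}" for z
    using assms by (intro cnt_image V_inj)
  have "?B \<inter> ?X = {}"
  proof (rule equals0I)
    fix y assume y: "y \<in> ?B \<inter> ?X"
    then obtain t where t: "t < m" "y = V t (Suc k)" by auto
    then have "y = V t k" using ge[of t y] le[of t] y by auto
    then show False using y t(1) by auto
  qed
  moreover have "cnt ?B z \<le> cnt ?A z" for z
    unfolding cntA cntB using le by (intro card_mono) (auto intro: le_less_trans)
  moreover have "cnt ?A y = cnt ?B y" if "y \<in> ?X" for y
  proof -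
    have "V t k < y \<longleftrightarrow> V t (Suc k) < y" if "t < m" for t
      using le[OF that] ge[OF that \<open>y \<in> ?X\<close>] by (meson le_less_trans not_less)
    then have "{t \<in> {..<m}. V t k < y} = {t \<in> {..<m}. V t (Suc k) < y}" by auto
    then show ?thesis unfolding cntA cntB by simp
  qed
  ultimately show ?thesis unfolding matching_def by blast
qed

lemma left_key_column_lines:
  assumes "j < c"
  shows "left_key_column S (Suc j) = sorted_list_of_set ((\<lambda>t. V t 0) ` {..<\<beta> j})"
proof -
  interpret key_column S \<beta> c j "\<lambda>k. (\<lambda>t. V t k) ` {..<\<beta> j}"
  proof
    show "semistandard S" "dom S = skew_dom 0 \<beta>" "\<beta> (Suc k) \<le> \<beta> k" "0 < \<beta> k \<longleftrightarrow> k < c" "j < c" for k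
      by (fact S dom anti pos assms)+
    fix k
    show "(\<lambda>t. V t k) ` {..<\<beta> j} \<subseteq> entries S (Suc k)" "card ((\<lambda>t. V t k) ` {..<\<beta> j}) = \<beta> j" if "k \<le> j"
      using beta_le[OF that] V_inj[of "\<beta> j" k] V_entries by (auto simp: card_image)
    show "matching ((\<lambda>t. V t k) ` {..<\<beta> j}) (entries S (Suc k) - (\<lambda>t. V t k) ` {..<\<beta> j})
      ((\<lambda>t. V t (Suc k)) ` {..<\<beta> j})" if "k < j"
      using beta_le[of "Suc k" j] that by (intro matching_lines) simp
  qed
  show ?thesis by (rule left_key_column_eq)
qed

lemma line_head_lines: "t < \<beta> 0 \<Longrightarrow> line_head ((delete_line ^^ t) S) = V t 0"
  using length_Cs[of 0 t] length_maximal_line[of "Cs t"]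
  unfolding line_head_def V_def Cs_def by (metis hd_conv_nth length_greater_0_conv)

end

section \<open>Maximal coset representatives in Bruhat order\<close>

text \<open>Swapping the two positions in both coordinates sends inversions injectively to
  inversions and misses the new one, \<open>(i, Suc i)\<close>.\<close>

lemma perm_length_swap:
  assumes i: "1 \<le> i" "Suc i \<le> n" and lt: "\<sigma> i < \<sigma> (Suc i)"
  shows "perm_length n \<sigma> < perm_length n (\<sigma> \<circ> Transposition.transpose i (Suc i))"
proof -
  let ?s = "Transposition.transpose i (Suc i)"
  let ?I = "\<lambda>\<sigma>. {(i, j). 1 \<le> i \<and> i < j \<and> j \<le> n \<and> \<sigma> j < (\<sigma> i :: nat)}"
  have fin: "finite (?I f)" for f
    by (rule finite_subset[of _ "{1..n} \<times> {1..n}"]) auto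
  have psub: "A \<subseteq> B - {z} \<Longrightarrow> z \<in> B \<Longrightarrow> A \<subset> B" for A B and z :: cell by blast
  have "map_prod ?s ?s ` ?I \<sigma> \<subseteq> ?I (\<sigma> \<circ> ?s) - {(i, Suc i)}"
  proof
    fix x assume "x \<in> map_prod ?s ?s ` ?I \<sigma>"
    then obtain a b where ab: "x = (?s a, ?s b)" "1 \<le> a" "a < b" "b \<le> n" "\<sigma> b < \<sigma> a" by auto
    have "\<not> (a = i \<and> b = Suc i)" using ab(5) lt by auto
    then have "?s a < ?s b" "1 \<le> ?s a" "?s b \<le> n" using ab i by (auto simp: transpose_def)
    moreover have "(?s a, ?s b) \<noteq> (i, Suc i)" using ab(3) by (auto simp: transpose_def split: if_splits)
    ultimately show "x \<in> ?I (\<sigma> \<circ> ?s) - {(i, Suc i)}" using ab by simp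
  qed
  moreover have "(i, Suc i) \<in> ?I (\<sigma> \<circ> ?s)" using i lt by simp
  ultimately have "map_prod ?s ?s ` ?I \<sigma> \<subset> ?I (\<sigma> \<circ> ?s)" by (rule psub)
  then have "card (map_prod ?s ?s ` ?I \<sigma>) < card (?I (\<sigma> \<circ> ?s))" by (rule psubset_card_mono[OF fin])
  moreover have "inj (map_prod ?s ?s)" by (intro prod.inj_map) simp_all
  ultimately show ?thesis unfolding perm_length_def by (simp add: card_image inj_on_subset)
qed

lemma perm_length_le: "perm_length n \<sigma> \<le> n * n"
proof -
  have "perm_length n \<sigma> \<le> card ({1..n} \<times> {1..n})"
    unfolding perm_length_def by (rule card_mono) auto
  then show ?thesis by simp
qed

lemma bruhat_le_length:
  assumes "bruhat_le n u v"
  shows "u = v \<or> perm_length n u < perm_length n v"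
proof -
  have "(bruhat_step n)\<^sup>*\<^sup>* u v" using assms by (simp add: bruhat_le_def)
  then show ?thesis
  proof (induction rule: rtranclp_induct)
    case (step v w)
    have "perm_length n v < perm_length n w" using step.hyps(2) by (simp add: bruhat_step_def)
    then show ?case using step.IH by (metis less_trans)
  qed simp
qed

section \<open>Permutations decreasing on blocks of equal parts\<close>

definition block_decreasing :: "nat \<Rightarrow> (nat \<Rightarrow> nat) \<Rightarrow> (nat \<Rightarrow> nat) \<Rightarrow> bool" where
  "block_decreasing n \<mu> \<sigma> \<longleftrightarrow>
     (\<forall>i. 1 \<le> i \<longrightarrow> Suc i \<le> n \<longrightarrow> \<mu> i = \<mu> (Suc i) \<longrightarrow> \<sigma> (Suc i) < \<sigma> i)"

lemma block_decreasingD: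
  assumes \<mu>: "antimono_on {1..n} \<mu>" and "block_decreasing n \<mu> \<sigma>"
    "1 \<le> i" "i < j" "j \<le> n" "\<mu> i = \<mu> j"
  shows "\<sigma> j < \<sigma> i"
proof -
  have eq: "\<mu> l = \<mu> i" if "i \<le> l" "l \<le> j" for l
  proof (rule antisym)
    show "\<mu> l \<le> \<mu> i" by (rule monotone_onD[OF \<mu>]) (use that assms in auto)
    show "\<mu> i \<le> \<mu> l" unfolding assms(6) by (rule monotone_onD[OF \<mu>]) (use that assms in auto)
  qed
  have step: "\<sigma> (Suc l) < \<sigma> l" if "i \<le> l" "Suc l \<le> j" for l
    using assms(2,3,5) that eq[of l] eq[of "Suc l"] by (simp add: block_decreasing_def)
  have "\<sigma> l < \<sigma> i" if "Suc i \<le> l" "l \<le> j" for l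
    using that
  proof (induction l rule: dec_induct)
    case base
    then show ?case using step[of i] by simp
  next
    case (step l)
    then show ?case using \<open>\<And>l. i \<le> l \<Longrightarrow> Suc l \<le> j \<Longrightarrow> \<sigma> (Suc l) < \<sigma> l\<close>[of l] by simp
  qed
  then show ?thesis using assms(4) by simp
qed

lemma stabiliserD:
  assumes "w \<in> stabiliser n \<mu>"
  shows "w permutes {1..n}" "i \<in> {1..n} \<Longrightarrow> \<mu> (w i) = \<mu> i"
proof -
  show w: "w permutes {1..n}" using assms by (simp add: stabiliser_def)
  assume "i \<in> {1..n}"
  then have "w i \<in> {1..n}" using permutes_in_image[OF w] by blast
  then have "\<mu> (inv w (w i)) = \<mu> (w i)" using assms by (simp add: stabiliser_def act_def)
  then show "\<mu> (w i) = \<mu> i" by (simp add: permutes_inverses(2)[OF w])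
qed

lemma stabiliser_swap:
  assumes w: "w \<in> stabiliser n \<mu>" and i: "1 \<le> i" "Suc i \<le> n" "\<mu> i = \<mu> (Suc i)"
  shows "w \<circ> Transposition.transpose i (Suc i) \<in> stabiliser n \<mu>"
proof -
  let ?s = "Transposition.transpose i (Suc i)"
  have p: "w permutes {1..n}" "?s permutes {1..n}"
    using w i by (auto simp: stabiliser_def intro: permutes_swap_id)
  have "inv (w \<circ> ?s) = ?s \<circ> inv w"
    using o_inv_distrib[OF permutes_bij[OF p(1)] permutes_bij[OF p(2)]] by simp
  moreover have "\<mu> (?s x) = \<mu> x" for x using i(3) by (auto simp: transpose_def)
  ultimately show ?thesis
    using w permutes_compose[OF p(2,1)] by (simp add: stabiliser_def act_def)
qed

text \<open>At the least index \<open>i\<close> moved by \<open>w\<close>, both \<open>w i\<close>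
  and the preimage of \<open>i\<close> lie to the right of \<open>i\<close> in the same block. Then
  \<open>\<tau>\<close> requires \<open>\<tau> (w i) < \<tau> i\<close>, and
  \<open>\<tau> \<circ> w\<close> requires the reverse.\<close>

lemma block_decreasing_unique:
  assumes \<mu>: "antimono_on {1..n} \<mu>" and w: "w \<in> stabiliser n \<mu>"
    and dec: "block_decreasing n \<mu> \<tau>" "block_decreasing n \<mu> (\<tau> \<circ> w)"
  shows "w = id"
proof -
  note p = stabiliserD(1)[OF w] and \<mu>w = stabiliserD(2)[OF w]
  have "w i = i" for i
  proof (induction i rule: less_induct)
    case (less i)
    show ?case
    proof (cases "i \<in> {1..n}")
      case False
      then show ?thesis using permutes_not_in[OF p] by blast
    next
      case True
      show ?thesis
      proof (rule ccontr)
        assume ne: "w i \<noteq> i"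
        have "\<not> w i < i" using less[of "w i"] permutes_inj[OF p] ne by (auto dest: injD)
        then have wi: "i < w i" using ne by simp
        obtain j where j: "w j = i" using permutes_surj[OF p] by (metis surjD)
        have "\<not> j < i" using less[of j] j by auto
        then have ij: "i < j" using j ne by (cases "i = j") auto
        have "w i \<in> {1..n}" "j \<in> {1..n}" using permutes_in_image[OF p] True j by metis+
        moreover from this have "\<mu> (w i) = \<mu> i" "\<mu> j = \<mu> i" using \<mu>w[OF True] \<mu>w[of j] j by simp_all
        ultimately have "\<tau> (w i) < \<tau> i" "(\<tau> \<circ> w) j < (\<tau> \<circ> w) i"
          using block_decreasingD[OF \<mu> dec(1), of i "w i"] block_decreasingD[OF \<mu> dec(2), of i j]
            True wi ij by simp_all
        then show False using j by simp
      qed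
    qed
  qed
  then show ?thesis by auto
qed

text \<open>Every coset element other than \<open>\<tau>\<close> has an ascent inside a block, hence
  a Bruhat step upwards within the coset. A longest element admits no such step, so it is
  \<open>\<tau>\<close>.\<close>

lemma bruhat_maximal_iff:
  assumes \<mu>: "antimono_on {1..n} \<mu>" and \<tau>: "\<tau> permutes {1..n}" "block_decreasing n \<mu> \<tau>"
  shows "bruhat_maximal n (left_coset \<tau> (stabiliser n \<mu>)) \<sigma> \<longleftrightarrow> \<sigma> = \<tau>"
proof -
  let ?C = "left_coset \<tau> (stabiliser n \<mu>)"
  have perm: "\<rho> permutes {1..n}" if mem: "\<rho> \<in> ?C" for \<rho>
  proof -
    obtain w where "w \<in> stabiliser n \<mu>" "\<rho> = \<tau> \<circ> w" using mem by (auto simp: left_coset_def)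
    then show ?thesis using permutes_compose[OF stabiliserD(1) \<tau>(1)] by blast
  qed
  have ascent: "\<exists>\<rho>'\<in>?C. bruhat_step n \<rho> \<rho>'" if \<rho>: "\<rho> \<in> ?C" "\<rho> \<noteq> \<tau>" for \<rho>
  proof -
    obtain w where w: "w \<in> stabiliser n \<mu>" "\<rho> = \<tau> \<circ> w" using \<rho>(1) by (auto simp: left_coset_def)
    then have "\<not> block_decreasing n \<mu> \<rho>"
      using block_decreasing_unique[OF \<mu> w(1) \<tau>(2)] \<rho>(2) by auto
    then obtain i where i: "1 \<le> i" "Suc i \<le> n" "\<mu> i = \<mu> (Suc i)" "\<not> \<rho> (Suc i) < \<rho> i"
      by (auto simp: block_decreasing_def)
    have "\<rho> (Suc i) \<noteq> \<rho> i" using permutes_inj[OF perm[OF \<rho>(1)]] by (simp add: inj_eq)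
    then have lt: "\<rho> i < \<rho> (Suc i)" using i(4) by simp
    let ?s = "Transposition.transpose i (Suc i)"
    have "\<rho> \<circ> ?s \<in> ?C"
      unfolding left_coset_def w(2) comp_assoc
      by (rule image_eqI[OF refl stabiliser_swap[OF w(1) i(1-3)]])
    moreover have "bruhat_step n \<rho> (\<rho> \<circ> ?s)"
      unfolding bruhat_step_def using perm[OF \<rho>(1)] perm_length_swap[of i n \<rho>, OF i(1,2) lt] i(1,2)
      by (intro conjI bexI[of _ i] bexI[of _ "Suc i"]) auto
    ultimately show ?thesis by blast
  qed
  have mem: "\<tau> \<in> ?C"
    unfolding left_coset_def
    by (rule image_eqI[of _ _ id]) (simp_all add: stabiliser_def act_def permutes_id)
  have "\<exists>\<rho>. \<rho> \<in> ?C \<and> (\<forall>\<rho>'. \<rho>' \<in> ?C \<longrightarrow> perm_length n \<rho>' \<le> perm_length n \<rho>)"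
    using ex_has_greatest_nat[where P = "\<lambda>\<rho>. \<rho> \<in> ?C" and f = "perm_length n" and k = \<tau>
        and b = "Suc (n * n)"] mem by (simp add: perm_length_le less_Suc_eq_le)
  then obtain \<rho> where \<rho>: "\<rho> \<in> ?C" "\<And>\<rho>'. \<rho>' \<in> ?C \<Longrightarrow> perm_length n \<rho>' \<le> perm_length n \<rho>" by blast
  then have "\<rho> = \<tau>" using ascent[of \<rho>] by (auto simp: bruhat_step_def not_less[symmetric])
  then have max: "perm_length n \<rho>' \<le> perm_length n \<tau>" if "\<rho>' \<in> ?C" for \<rho>' using \<rho>(2) that by simp
  show ?thesis
  proof
    assume "\<sigma> = \<tau>"
    then show "bruhat_maximal n ?C \<sigma>"
      unfolding bruhat_maximal_def using mem max bruhat_le_length by fastforce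
  next
    assume m: "bruhat_maximal n ?C \<sigma>"
    show "\<sigma> = \<tau>"
    proof (rule ccontr)
      assume "\<sigma> \<noteq> \<tau>"
      then obtain \<rho>' where \<rho>': "\<rho>' \<in> ?C" "bruhat_step n \<sigma> \<rho>'"
        using ascent m by (auto simp: bruhat_maximal_def)
      then have "bruhat_le n \<sigma> \<rho>'"
        using perm m by (auto simp: bruhat_le_def bruhat_maximal_def)
      then have "\<rho>' = \<sigma>" using m \<rho>'(1) by (simp add: bruhat_maximal_def)
      then show False using \<rho>'(2) by (simp add: bruhat_step_def)
    qed
  qed
qed

theorem theorem2p1:
  fixes n p :: nat and \<mu> :: "nat \<Rightarrow> nat" and S :: filling and \<tau> :: "nat \<Rightarrow> nat"
  assumes "1 \<le> n"
    and "antimono_on {1..n} \<mu>"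
    and "card {i \<in> {1..n}. \<mu> i \<noteq> 0} = p"
    and "ssyt n \<mu> S"
    and "\<tau> = line_perm n p S"
  shows "\<tau> permutes {1..n} \<and>
    left_key S = coset_key n \<mu> (left_coset \<tau> (stabiliser n \<mu>)) \<and>
    (\<forall>\<sigma>. bruhat_maximal n (left_coset \<tau> (stabiliser n \<mu>)) \<sigma> \<longleftrightarrow> \<sigma> = \<tau>)"
proof -
  define \<beta> where "\<beta> k = col_len (diagram n \<mu>) (Suc k)" for k
  have D: "dom S = diagram n \<mu>" and sst: "semistandard S" and ran: "ran S \<subseteq> {1..n}"
    using assms(4) by (simp_all add: ssyt_def)
  have \<beta>: "{1..\<beta> k} = {i \<in> {1..n}. Suc k \<le> \<mu> i}" for k
    unfolding \<beta>_def by (rule diagram_column[OF assms(2)]) simp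
  have \<beta>_iff: "t < \<beta> k \<longleftrightarrow> Suc t \<le> n \<and> Suc k \<le> \<mu> (Suc t)" for t k
  proof -
    have "t < \<beta> k \<longleftrightarrow> Suc t \<in> {1..\<beta> k}" by auto
    then show ?thesis unfolding \<beta> by auto
  qed
  have dom: "dom S = skew_dom 0 \<beta>"
  proof -
    have "(i, Suc k) \<in> diagram n \<mu> \<longleftrightarrow> i \<in> {1..\<beta> k}" for i k
      unfolding \<beta> by (auto simp: diagram_def)
    then have "(i, k) \<in> diagram n \<mu> \<longleftrightarrow> (i, k) \<in> skew_dom 0 \<beta>" for i k
      by (cases k) (auto simp: skew_dom_def diagram_def)
    then show ?thesis unfolding D by auto
  qed
  \<comment> \<open>The tableau has \<open>\<mu> 1\<close> columns, and \<open>\<beta> k\<close> is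
    the length of the one with index \<open>k\<close> counted from 0.\<close>
  interpret lines S \<beta> "\<mu> 1"
  proof
    show "\<beta> (Suc k) \<le> \<beta> k" for k using \<beta>_iff[of "\<beta> k" "Suc k"] \<beta>_iff[of "\<beta> k" k] by linarith
    show "0 < \<beta> k \<longleftrightarrow> k < \<mu> 1" for k using \<beta>_iff[of 0 k] assms(1) by auto
  qed (use sst dom in simp_all)
  have p: "p = \<beta> 0"
  proof -
    have "{i \<in> {1..n}. \<mu> i \<noteq> 0} = {1..\<beta> 0}" unfolding \<beta> by auto
    then show ?thesis using assms(3) by simp
  qed
  have pn: "p \<le> n" using \<beta>_iff[of n 0] p by linarith
  define H where "H = (\<lambda>t. V t 0) ` {..<p}"
  define rest where "rest = rev (sorted_list_of_set ({1..n} - H))"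
  have t: "(\<lambda>j. line_head ((delete_line ^^ (j - 1)) S)) ` {1..m} = (\<lambda>t. V t 0) ` {..<m}" if "m \<le> p" for m
  proof -
    have "{1..m} = Suc ` {..<m}" by (simp add: image_Suc_lessThan)
    then show ?thesis using line_head_lines p that by (simp add: image_image)
  qed
  have \<tau>_low: "\<tau> (Suc i) = V i 0" if "i < p" for i
    using that line_head_lines p by (simp add: assms(5) line_perm_def Let_def)
  have \<tau>_high: "\<tau> i = rest ! (i - p - 1)" if "p < i" "i \<le> n" for i
    using that t[OF order_refl] by (simp add: assms(5) line_perm_def Let_def rest_def H_def)
  have \<tau>_out: "\<tau> i = i" if "i \<notin> {1..n}" for i
    using that pn by (auto simp: assms(5) line_perm_def Let_def)
  have HS: "H \<subseteq> {1..n}"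
  proof
    fix x assume "x \<in> H"
    then obtain t where "t < \<beta> 0" "x = V t 0" by (auto simp: H_def p)
    then have "x \<in> ran S" using V_entries[of t 0] by (auto simp: entries_def ran_def)
    then show "x \<in> {1..n}" using ran by blast
  qed
  have \<tau>_image: "\<tau> ` {1..m} = (\<lambda>t. V t 0) ` {..<m}" if "m \<le> p" for m
  proof -
    have "{1..m} = Suc ` {..<m}" by (simp add: image_Suc_lessThan)
    then show ?thesis using \<tau>_low that by (simp add: image_image)
  qed
  have len: "length rest = n - p"
    using V_inj[of p 0] HS p by (simp add: rest_def card_Diff_subset finite_subset[OF HS] H_def card_image)
  have "\<tau> ` {p<..n} = set rest"
  proof (intro equalityI subsetI)
    fix x assume "x \<in> \<tau> ` {p<..n}"
    then show "x \<in> set rest" using \<tau>_high len by auto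
  next
    fix x assume "x \<in> set rest"
    then obtain i where "i < n - p" "x = rest ! i" unfolding in_set_conv_nth len by blast
    then show "x \<in> \<tau> ` {p<..n}" using \<tau>_high[of "Suc (i + p)"] by (intro image_eqI[of _ _ "Suc (i + p)"]) auto
  qed
  moreover have "{1..n} = {1..p} \<union> {p<..n}" using pn by auto
  moreover have "set rest = {1..n} - H" by (simp add: rest_def)
  ultimately have im: "\<tau> ` {1..n} = {1..n}"
    using \<tau>_image[OF order_refl] HS by (auto simp: image_Un simp flip: H_def)
  then have perm: "\<tau> permutes {1..n}"
    using \<tau>_out eq_card_imp_inj_on[of "{1..n}" \<tau>] by (intro bij_imp_permutes) (simp_all add: bij_betw_def)
  have "left_key S = key_tableau n \<mu> \<tau>"
  proof -
    have "left_key_column S k = sorted_list_of_set (\<tau> ` {1..col_len (diagram n \<mu>) k})"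
      if k: "k \<in> {1..\<mu> 1}" for k
    proof -
      obtain j where j: "k = Suc j" "j < \<mu> 1" using k by (cases k) auto
      have "\<beta> j \<le> p" using beta_le[of 0 j] p by simp
      then show ?thesis using left_key_column_lines[OF j(2)] \<tau>_image[of "\<beta> j"]
        by (simp add: j(1) \<beta>_def)
    qed
    then show ?thesis
      unfolding left_key_def key_tableau_def using num_cols D
      by (intro arg_cong[where f = of_columns] map_cong) auto
  qed
  moreover have "block_decreasing n \<mu> \<tau>"
    unfolding block_decreasing_def
  proof (intro allI impI)
    fix i assume i: "1 \<le> i" "Suc i \<le> n" "\<mu> i = \<mu> (Suc i)"
    show "\<tau> (Suc i) < \<tau> i"
    \<comment> \<open>Equal parts are either zero, and then both positions lie in the decreasing
      tail of \<open>\<tau>\<close>, or positive, and then the two lines have equal length.\<close>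
    proof (cases "\<mu> i = 0")
      case True
      then have "p < i" using \<beta>_iff[of "i - 1" 0] i p by simp
      have "sorted_wrt (>) rest" by (simp add: rest_def sorted_wrt_rev)
      then have "rest ! (i - p) < rest ! (i - p - 1)"
        using \<open>p < i\<close> i(2) len by (intro sorted_wrt_nth_less[where P = "(>)"]) auto
      then show ?thesis using \<tau>_high[of i] \<tau>_high[of "Suc i"] i \<open>p < i\<close> by simp
    next
      case False
      obtain t where t: "i = Suc t" using i(1) by (cases i) auto
      have same: "t < \<beta> k \<longleftrightarrow> Suc t < \<beta> k" for k using \<beta>_iff i t by simp
      have "t < \<beta> 0" using \<beta>_iff[of t 0] i t False by simp
      then show ?thesis using V_decreasing[OF same] same[of 0] \<tau>_low p t by simp
    qed
  qed
  ultimately show ?thesis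
    using perm coset_key_left_coset[OF assms(2)] bruhat_maximal_iff[OF assms(2) perm] by simp
qed

end
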